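(* There is a polynomial-time algorithm that, given an instance $(V,\mathcal{R},k)$ of \textsc{$k$-BetweennessTour} with $k<|V|/5$, either outputs an edition of $(V,\mathcal{R})$ of size at most $k$ or correctly answers that no such edition exists.
   Context: A betweenness triplet on $\{a,b,c\}$ chooses one of its elements ($abc$ chooses $b$); $\mathcal{R}$ is dense if it contains exactly one triplet on each 3-subset of $V$. A triplet $abc$ is consistent with a linear ordering $\sigma$ of $V$ if $b$ lies between $a$ and $c$; a set of triplets is consistent if some linear ordering is consistent with all of them. \textsc{$k$-BetweennessTour}: given $V$, a dense set $\mathcal{R}$ of betweenness triplets on $V$ and an integer $k$, decide whether some linear ordering of $V$ is consistent with all but at most $k$ triplets of $\mathcal{R}$. An edition is a set $\mathcal{F}\subseteq\mathcal{R}$ such that changing the chosen vertices of the triplets in $\mathcal{F}$ (suitably) yields a consistent set of triplets; its size is $|\mathcal{F}|$. *)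

theory Defs
  imports Complex_Main "HOL-Library.Log_Nat" "HOL-Computational_Algebra.Polynomial"
begin

section \<open>Betweenness triplets and editions\<close>

text \<open>A triplet is stored as its 3-element ground set together with the chosen element, so
  that \<open>abc\<close> and \<open>cba\<close> are the same triplet.\<close>

type_synonym 'v triplet = "'v set \<times> 'v"

definition btw :: "'v \<Rightarrow> 'v \<Rightarrow> 'v \<Rightarrow> 'v triplet" where
  "btw a b c = ({a, b, c}, b)"

definition triplet_on :: "'v set \<Rightarrow> 'v triplet \<Rightarrow> bool" where
  "triplet_on S t \<longleftrightarrow> card S = 3 \<and> fst t = S \<and> snd t \<in> S"

definition dense_triplets :: "'v set \<Rightarrow> 'v triplet set \<Rightarrow> bool" where
  "dense_triplets V R \<longleftrightarrow>
     (\<forall>t\<in>R. \<exists>S\<subseteq>V. triplet_on S t) \<and>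
     (\<forall>S\<subseteq>V. card S = 3 \<longrightarrow> (\<exists>!t. t \<in> R \<and> triplet_on S t))"

definition lies_between :: "'v rel \<Rightarrow> 'v \<Rightarrow> 'v \<Rightarrow> 'v \<Rightarrow> bool" where
  "lies_between \<sigma> a b c \<longleftrightarrow> (a, b) \<in> \<sigma> \<and> (b, c) \<in> \<sigma> \<or> (c, b) \<in> \<sigma> \<and> (b, a) \<in> \<sigma>"

definition consistent_with :: "'v rel \<Rightarrow> 'v triplet \<Rightarrow> bool" where
  "consistent_with \<sigma> t \<longleftrightarrow> (\<exists>a b c. t = btw a b c \<and> distinct [a, b, c] \<and> lies_between \<sigma> a b c)"

definition consistent :: "'v set \<Rightarrow> 'v triplet set \<Rightarrow> bool" where
  "consistent V R \<longleftrightarrow> (\<exists>\<sigma>. linear_order_on V \<sigma> \<and> (\<forall>t\<in>R. consistent_with \<sigma> t))"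

text \<open>Every triplet of an edition is really changed: its new chosen vertex differs from the
  old one.\<close>

definition edition :: "'v set \<Rightarrow> 'v triplet set \<Rightarrow> 'v triplet set \<Rightarrow> bool" where
  "edition V R F \<longleftrightarrow> F \<subseteq> R \<and>
     (\<exists>new. (\<forall>t\<in>F. new t \<in> fst t \<and> new t \<noteq> snd t) \<and>
            consistent V ((R - F) \<union> (\<lambda>t. (fst t, new t)) ` F))"


section \<open>Random access machine programs\<close>

text \<open>
  The instruction set is that of the Cook--Reckhow RAM (constants, addition, subtraction,
  indirect access, output, test for positivity), with structured control flow in place of jumps
  and with the input preloaded into memory. Cells hold integers and are addressed by integers.
  Every instruction and every test costs one step. As there is no multiplication, the bit length
  of the largest absolute value in memory grows by at most one per step, up to the fixed constants
  of the program; hence polynomially many steps in this model amount to polynomial time on a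
  Turing machine.
\<close>

datatype prog =
    Skip
  | Const int int          \<comment> \<open>\<open>x\<^sub>i := c\<close>\<close>
  | Add int int int        \<comment> \<open>\<open>x\<^sub>i := x\<^sub>j + x\<^sub>l\<close>\<close>
  | Sub int int int        \<comment> \<open>\<open>x\<^sub>i := x\<^sub>j - x\<^sub>l\<close>\<close>
  | Load int int           \<comment> \<open>\<open>x\<^sub>i := x[x\<^sub>j]\<close>\<close>
  | Store int int          \<comment> \<open>\<open>x[x\<^sub>i] := x\<^sub>j\<close>\<close>
  | Print int
  | Seq prog prog
  | IfPos int prog prog
  | WhilePos int prog

type_synonym memory = "int \<Rightarrow> int"

text \<open>A state consists of the memory and the words printed so far. In \<open>run c s t s'\<close>,
  the number \<open>t\<close> counts the steps of the terminating execution of \<open>c\<close> from \<open>s\<close> to \<open>s'\<close>.\<close>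

type_synonym state = "memory \<times> int list"

inductive run :: "prog \<Rightarrow> state \<Rightarrow> nat \<Rightarrow> state \<Rightarrow> bool" where
  Skip: "run Skip s 1 s"
| Const: "run (Const i c) (m, out) 1 (m(i := c), out)"
| Add: "run (Add i j l) (m, out) 1 (m(i := m j + m l), out)"
| Sub: "run (Sub i j l) (m, out) 1 (m(i := m j - m l), out)"
| Load: "run (Load i j) (m, out) 1 (m(i := m (m j)), out)"
| Store: "run (Store i j) (m, out) 1 (m(m i := m j), out)"
| Print: "run (Print i) (m, out) 1 (m, out @ [m i])"
| Seq: "run c\<^sub>1 s t\<^sub>1 s' \<Longrightarrow> run c\<^sub>2 s' t\<^sub>2 s'' \<Longrightarrow> run (Seq c\<^sub>1 c\<^sub>2) s (t\<^sub>1 + t\<^sub>2) s''"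
| IfPosTrue: "fst s i > 0 \<Longrightarrow> run c\<^sub>1 s t s' \<Longrightarrow> run (IfPos i c\<^sub>1 c\<^sub>2) s (1 + t) s'"
| IfPosFalse: "\<not> fst s i > 0 \<Longrightarrow> run c\<^sub>2 s t s' \<Longrightarrow> run (IfPos i c\<^sub>1 c\<^sub>2) s (1 + t) s'"
| WhilePosFalse: "\<not> fst s i > 0 \<Longrightarrow> run (WhilePos i c) s 1 s"
| WhilePosTrue: "fst s i > 0 \<Longrightarrow> run c s t\<^sub>1 s' \<Longrightarrow> run (WhilePos i c) s' t\<^sub>2 s'' \<Longrightarrow>
    run (WhilePos i c) s (1 + t\<^sub>1 + t\<^sub>2) s''"

lemma run_deterministic: "run c s t s' \<Longrightarrow> run c s u r \<Longrightarrow> u = t \<and> r = s'"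
proof (induction arbitrary: u r rule: run.induct)
  case (Seq c\<^sub>1 s t\<^sub>1 s' c\<^sub>2 t\<^sub>2 s'')
  from Seq.prems show ?case by cases (metis Seq.IH)
next
  case (IfPosTrue s i c\<^sub>1 t s' c\<^sub>2)
  from IfPosTrue.prems IfPosTrue.hyps(1) show ?case by cases (auto dest!: IfPosTrue.IH)
next
  case (IfPosFalse s i c\<^sub>2 t s' c\<^sub>1)
  from IfPosFalse.prems IfPosFalse.hyps(1) show ?case by cases (auto dest!: IfPosFalse.IH)
next
  case (WhilePosFalse s i c)
  from WhilePosFalse.prems WhilePosFalse.hyps show ?case by cases auto
next
  case (WhilePosTrue s i c t\<^sub>1 s' t\<^sub>2 s'')
  from WhilePosTrue.prems WhilePosTrue.hyps(1) show ?case by cases (simp, metis WhilePosTrue.IH)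
qed (erule run.cases; simp)+

definition load_input :: "int list \<Rightarrow> memory" where
  "load_input ws = (\<lambda>i. if 0 \<le> i \<and> i < int (length ws) then ws ! nat i else 0)"

definition outputs_within :: "prog \<Rightarrow> int list \<Rightarrow> nat \<Rightarrow> int list \<Rightarrow> bool" where
  "outputs_within c ws T out \<longleftrightarrow> (\<exists>t m. t \<le> T \<and> run c (load_input ws, []) t (m, out))"

text \<open>Size of an input in bits: the binary digits of each word, plus one for its sign.\<close>

definition bit_size :: "int list \<Rightarrow> nat" where
  "bit_size ws = (\<Sum>x\<leftarrow>ws. 1 + floorlog 2 (nat \<bar>x\<bar>))"


section \<open>Encoding of instances and answers\<close>

text \<open>Vertices are arbitrary natural numbers. Vertices and triplets may be listed in any order,
  and a triplet may be written as \<open>abc\<close> or \<open>cba\<close>.\<close>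

definition encodes_triplets :: "nat triplet set \<Rightarrow> int list \<Rightarrow> bool" where
  "encodes_triplets R ws \<longleftrightarrow>
     (\<exists>abcs. distinct (map (\<lambda>(a, b, c). btw a b c) abcs) \<and>
             set (map (\<lambda>(a, b, c). btw a b c) abcs) = R \<and>
             ws = int (length abcs) # concat (map (\<lambda>(a, b, c). [int a, int b, int c]) abcs))"

definition encodes_instance :: "nat set \<Rightarrow> nat triplet set \<Rightarrow> int \<Rightarrow> int list \<Rightarrow> bool" where
  "encodes_instance V R k ws \<longleftrightarrow>
     (\<exists>vs us. distinct vs \<and> set vs = V \<and> encodes_triplets R us \<and>
              ws = k # int (length vs) # map int vs @ us)"

definition answers_edition :: "nat triplet set \<Rightarrow> int list \<Rightarrow> bool" where
  "answers_edition F out \<longleftrightarrow> (\<exists>us. encodes_triplets F us \<and> out = 1 # us)"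

definition answers_none :: "int list \<Rightarrow> bool" where
  "answers_none out \<longleftrightarrow> out = [0]"

end

theory Submission imports Defs begin

text \<open>
  An edition of size at most \<open>k < |V|/5\<close> touches at most \<open>3k\<close> vertices, so, if \<open>|V| > 1\<close>, for any
  fixed reference vertex \<open>u\<close> some other vertex \<open>v\<close> is contained in no edited triplet. The triplets
  through \<open>v\<close> then agree with the target ordering \<open>\<sigma>\<close> and determine it up to reversal: whether two
  vertices lie on the same side of \<open>v\<close>, and, if so, which of them is closer to \<open>v\<close>. Hence it suffices
  to try every \<open>v\<close>: the triplets through \<open>v\<close> yield integer keys that sort the vertices like \<open>\<sigma>\<close>
  whenever \<open>v\<close> is untouched, where \<open>u\<close> fixes the direction. The keys are always pairwise distinct, so
  whatever \<open>v\<close> is, the triplets inconsistent with the order of the keys form an edition.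
\<close>

section \<open>Betweenness in linear orders\<close>

lemma lies_between_commute: "lies_between \<sigma> a b c \<longleftrightarrow> lies_between \<sigma> c b a"
  by (auto simp: lies_between_def)

lemma lies_between_converse: "lies_between (\<sigma>\<inverse>) a b c \<longleftrightarrow> lies_between \<sigma> a b c"
  by (auto simp: lies_between_def)

lemma consistent_with_converse: "consistent_with (\<sigma>\<inverse>) t \<longleftrightarrow> consistent_with \<sigma> t"
  by (simp add: consistent_with_def lies_between_converse)

lemma btw_eq_iff:
  assumes "distinct [x, y, z]"
  shows "btw x y z = btw p q r \<longleftrightarrow> y = q \<and> (x = p \<and> z = r \<or> x = r \<and> z = p)"
proof
  assume "btw x y z = btw p q r"
  then have "y = q" "x \<in> {p, q, r}" "z \<in> {p, q, r}"
    by (auto simp: btw_def)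
  then show "y = q \<and> (x = p \<and> z = r \<or> x = r \<and> z = p)"
    using assms by auto
qed (auto simp: btw_def)

lemma consistent_with_btw:
  assumes "distinct [x, y, z]"
  shows "consistent_with \<sigma> (btw x y z) \<longleftrightarrow> lies_between \<sigma> x y z"
  using assms unfolding consistent_with_def by (auto simp: btw_eq_iff lies_between_def)

lemma consistent_with_memE:
  assumes "consistent_with \<sigma> (S, b)" "a \<in> S" "a \<noteq> b"
  obtains c where "S = {a, b, c}" "distinct [a, b, c]" "lies_between \<sigma> a b c"
proof -
  obtain x z where "S = {x, b, z}" "distinct [x, b, z]" "lies_between \<sigma> x b z"
    using assms(1) unfolding consistent_with_def btw_def by auto
  moreover have "a = x \<or> a = z"
    using assms(2,3) calculation(1) by blast
  ultimately show thesis
    using that[of x] that[of z] by (auto simp: lies_between_commute insert_commute)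
qed

lemma consistent_with_unique:
  assumes "linear_order_on V \<sigma>" "consistent_with \<sigma> (S, b)" "consistent_with \<sigma> (S, b')"
  shows "b = b'"
proof (rule ccontr)
  assume "b \<noteq> b'"
  have "b \<in> S" "b' \<in> S"
    using assms(2,3) unfolding consistent_with_def btw_def by auto
  obtain c where c: "S = {b', b, c}" "distinct [b', b, c]" "lies_between \<sigma> b' b c"
    using consistent_with_memE[OF assms(2) \<open>b' \<in> S\<close>] \<open>b \<noteq> b'\<close> by metis
  obtain c' where c': "S = {b, b', c'}" "distinct [b, b', c']" "lies_between \<sigma> b b' c'"
    using consistent_with_memE[OF assms(3) \<open>b \<in> S\<close> \<open>b \<noteq> b'\<close>] .
  have "c' = c"
    using c(1,2) c'(1,2) by auto
  moreover have "antisym \<sigma>" "trans \<sigma>"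
    using assms(1) by (simp_all add: order_on_defs)
  ultimately show False
    using c(2,3) c'(3) unfolding lies_between_def
    by (metis antisymD distinct_length_2_or_more transD)
qed

lemma ex_consistent_with:
  assumes "linear_order_on V \<sigma>" "S \<subseteq> V" "card S = 3"
  shows "\<exists>b\<in>S. consistent_with \<sigma> (S, b)"
proof -
  obtain x y z where S: "S = {x, y, z}" "distinct [x, y, z]"
    using assms(3) by (auto simp: card_3_iff)
  have "(x, y) \<in> \<sigma> \<or> (y, x) \<in> \<sigma>" "(y, z) \<in> \<sigma> \<or> (z, y) \<in> \<sigma>" "(x, z) \<in> \<sigma> \<or> (z, x) \<in> \<sigma>"
    using assms(1,2) S by (auto simp: order_on_defs total_on_def)
  then have "lies_between \<sigma> x y z \<or> lies_between \<sigma> y x z \<or> lies_between \<sigma> x z y"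
    unfolding lies_between_def by blast
  moreover have "btw x y z = (S, y)" "btw y x z = (S, x)" "btw x z y = (S, z)"
    using S(1) by (auto simp: btw_def)
  ultimately show ?thesis
    using S consistent_with_btw[of x y z \<sigma>] consistent_with_btw[of y x z \<sigma>]
      consistent_with_btw[of x z y \<sigma>] by auto
qed

definition inconsistent_triplets :: "'v triplet set \<Rightarrow> 'v rel \<Rightarrow> 'v triplet set" where
  "inconsistent_triplets R \<sigma> = {t \<in> R. \<not> consistent_with \<sigma> t}"

lemma edition_inconsistent_triplets:
  assumes lin: "linear_order_on V \<sigma>" and on: "\<And>t. t \<in> R \<Longrightarrow> \<exists>S\<subseteq>V. triplet_on S t"
  shows "edition V R (inconsistent_triplets R \<sigma>)"
proof -
  have "\<exists>b. b \<in> fst t \<and> consistent_with \<sigma> (fst t, b)" if "t \<in> R" for t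
    using ex_consistent_with[OF lin] on[OF that] by (auto simp: triplet_on_def)
  then obtain new where new: "\<And>t. t \<in> R \<Longrightarrow> new t \<in> fst t \<and> consistent_with \<sigma> (fst t, new t)"
    by metis
  moreover have "new t \<noteq> snd t" if "t \<in> inconsistent_triplets R \<sigma>" for t
    using that new[of t] by (auto simp: inconsistent_triplets_def)
  ultimately show ?thesis
    unfolding edition_def consistent_def using lin
    by (intro conjI exI[of _ new] exI[of _ \<sigma>]) (auto simp: inconsistent_triplets_def)
qed

lemma editionE:
  assumes "edition V R F"
  obtains \<sigma> where "linear_order_on V \<sigma>" "inconsistent_triplets R \<sigma> \<subseteq> F"
proof -
  obtain \<sigma> where "linear_order_on V \<sigma>" "\<And>t. t \<in> R - F \<Longrightarrow> consistent_with \<sigma> t"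
    using assms unfolding edition_def consistent_def by (metis Un_iff)
  then show thesis
    using that unfolding inconsistent_triplets_def by blast
qed

definition key_order :: "'v set \<Rightarrow> ('v \<Rightarrow> 'k::linorder) \<Rightarrow> 'v rel" where
  "key_order V K = relation_of (\<lambda>a b. K a \<le> K b) V"

lemma linear_order_on_key_order:
  assumes "inj_on K V"
  shows "linear_order_on V (key_order V K)"
  using assms unfolding key_order_def relation_of_def order_on_defs
  by (auto simp: refl_on_def trans_def antisym_def total_on_def dest: inj_onD)

lemma consistent_with_key_order:
  assumes "inj_on K V" "distinct [x, y, z]" "{x, y, z} \<subseteq> V"
  shows "consistent_with (key_order V K) (btw x y z) \<longleftrightarrow>
    K x < K y \<and> K y < K z \<or> K z < K y \<and> K y < K x"
proof -
  have "K x \<noteq> K y" "K y \<noteq> K z" "K x \<noteq> K z"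
    using assms by (auto dest: inj_onD)
  then show ?thesis
    using assms by (auto simp: consistent_with_btw lies_between_def key_order_def relation_of_def)
qed

lemma key_order_eqI:
  assumes lin: "linear_order_on V \<sigma>" and mono: "\<And>a b. (a, b) \<in> \<sigma> \<Longrightarrow> a \<noteq> b \<Longrightarrow> K a < K b"
  shows "key_order V K = \<sigma>"
proof -
  have "(a, b) \<in> \<sigma> \<longleftrightarrow> K a \<le> K b" if "a \<in> V" "b \<in> V" for a b
  proof (cases "a = b")
    case True
    then show ?thesis
      using lin that by (simp add: order_on_defs refl_on_def)
  next
    case False
    then have "(a, b) \<in> \<sigma> \<or> (b, a) \<in> \<sigma>"
      using lin that by (simp add: order_on_defs total_on_def)
    then show ?thesis
      using mono[of a b] mono[of b a] False by auto
  qed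
  moreover have "\<sigma> \<subseteq> V \<times> V"
    using lin by (simp add: order_on_defs)
  ultimately show ?thesis
    unfolding key_order_def relation_of_def by auto
qed

definition break_ties :: "int \<Rightarrow> ('v \<Rightarrow> int) \<Rightarrow> ('v \<Rightarrow> int) \<Rightarrow> 'v \<Rightarrow> int" where
  "break_ties N r f a = N * f a + r a"

lemma break_ties_strict_mono:
  assumes "f a < f b" "r a \<in> {0..<N}" "r b \<in> {0..<N}"
  shows "break_ties N r f a < break_ties N r f b"
proof -
  have "N * (f a + 1) \<le> N * f b"
    using assms by (intro mult_left_mono) auto
  then show ?thesis
    using assms(2,3) by (simp add: break_ties_def algebra_simps)
qed

lemma inj_on_break_ties:
  assumes "inj_on r V" "r ` V \<subseteq> {0..<N}"
  shows "inj_on (break_ties N r f) V"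
proof (rule inj_onI)
  fix a b assume ab: "a \<in> V" "b \<in> V" "break_ties N r f a = break_ties N r f b"
  have "break_ties N r f c mod N = r c" if "c \<in> V" for c
    using assms(2) that by (auto simp: break_ties_def)
  then have "r a = r b"
    using ab by metis
  then show "a = b"
    using inj_onD[OF assms(1)] ab by blast
qed

section \<open>The ordering around an untouched vertex\<close>

lemma dense_tripletsD:
  assumes "dense_triplets V R" "t \<in> R"
  shows "fst t \<subseteq> V" "card (fst t) = 3" "snd t \<in> fst t"
  using assms unfolding dense_triplets_def triplet_on_def by blast+

lemma finite_dense_triplets:
  assumes "finite V" "dense_triplets V R"
  shows "finite R"
proof (rule finite_subset)
  show "R \<subseteq> Pow V \<times> V"
    using dense_tripletsD[OF assms(2)] by (fastforce simp: mem_Times_iff)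
qed (use assms(1) in simp)

lemma dense_tripletsE:
  assumes "dense_triplets V R" "t \<in> R"
  obtains x y z where "t = btw x y z" "distinct [x, y, z]" "{x, y, z} \<subseteq> V"
proof -
  obtain S b where t: "t = (S, b)" "S \<subseteq> V" "card S = 3" "b \<in> S"
    using dense_tripletsD[OF assms] by (metis prod.collapse)
  then obtain x z where "S - {b} = {x, z}" "x \<noteq> z"
    by (metis card_2_iff card_Diff_singleton diff_Suc_1 numeral_2_eq_2 numeral_3_eq_3)
  then show thesis
    using t by (intro that[of x b z]) (auto simp: btw_def)
qed

lemma dense_triplets_btwD:
  assumes "dense_triplets V R" "btw p q r \<in> R"
  shows "distinct [p, q, r]" "{p, q, r} \<subseteq> V"
proof -
  obtain x y z where "btw p q r = btw x y z" "distinct [x, y, z]" "{x, y, z} \<subseteq> V"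
    using dense_tripletsE[OF assms] .
  moreover from this have "y = q \<and> (x = p \<and> z = r \<or> x = r \<and> z = p)"
    by (metis btw_eq_iff)
  ultimately show "distinct [p, q, r]" "{p, q, r} \<subseteq> V"
    by auto
qed



lemma btw_mem_iff_lies_between:
  assumes dense: "dense_triplets V R" and lin: "linear_order_on V \<sigma>"
    and pqr: "distinct [p, q, r]" "{p, q, r} \<subseteq> V"
    and cons: "\<And>t. t \<in> R \<Longrightarrow> fst t = {p, q, r} \<Longrightarrow> consistent_with \<sigma> t"
  shows "btw p q r \<in> R \<longleftrightarrow> lies_between \<sigma> p q r"
proof
  assume "btw p q r \<in> R"
  then show "lies_between \<sigma> p q r"
    using cons[of "btw p q r"] consistent_with_btw[OF pqr(1)] by (simp add: btw_def)
next
  assume "lies_between \<sigma> p q r"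
  then have "consistent_with \<sigma> ({p, q, r}, q)"
    using consistent_with_btw[OF pqr(1)] by (simp add: btw_def)
  moreover have "card {p, q, r} = 3"
    using pqr(1) by simp
  then obtain b where b: "({p, q, r}, b) \<in> R"
    using dense pqr(2) unfolding dense_triplets_def triplet_on_def by (metis prod.collapse)
  moreover have "consistent_with \<sigma> ({p, q, r}, b)"
    using cons[OF b] by simp
  ultimately have "b = q"
    using consistent_with_unique[OF lin] by blast
  then show "btw p q r \<in> R"
    using b by (simp add: btw_def)
qed

definition depth :: "'v triplet set \<Rightarrow> 'v \<Rightarrow> 'v \<Rightarrow> nat" where
  "depth R v a = card {y. btw v y a \<in> R}"

text \<open>Positions are positive on the side of the reference vertex \<open>u\<close>.\<close>

definition position :: "'v triplet set \<Rightarrow> 'v \<Rightarrow> 'v \<Rightarrow> 'v \<Rightarrow> int" where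
  "position R v u a =
     (if a = v then 0
      else if btw u v a \<in> R then - (1 + int (depth R v a))
      else 1 + int (depth R v a))"

locale order_around =
  fixes V :: "'v set" and R :: "'v triplet set" and \<sigma> :: "'v rel" and v :: 'v
  assumes finite_V: "finite V" and dense: "dense_triplets V R"
    and linear: "linear_order_on V \<sigma>" and centre: "v \<in> V"
    and consistent_at_centre: "\<And>t. t \<in> R \<Longrightarrow> v \<in> fst t \<Longrightarrow> consistent_with \<sigma> t"
begin

lemma before_field: "(p, q) \<in> \<sigma> \<Longrightarrow> p \<in> V \<and> q \<in> V"
  using linear by (auto simp: order_on_defs)

lemma before_antisym: "(p, q) \<in> \<sigma> \<Longrightarrow> (q, p) \<in> \<sigma> \<Longrightarrow> p = q"
  using linear by (auto simp: order_on_defs dest: antisymD)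

lemma before_trans: "(p, q) \<in> \<sigma> \<Longrightarrow> (q, r) \<in> \<sigma> \<Longrightarrow> (p, r) \<in> \<sigma>"
  using linear by (auto simp: order_on_defs dest: transD)

lemma before_total: "p \<in> V \<Longrightarrow> q \<in> V \<Longrightarrow> (p, q) \<in> \<sigma> \<or> (q, p) \<in> \<sigma>"
  using linear by (cases "p = q") (auto simp: order_on_defs total_on_def refl_on_def)

lemma btw_centre_mem_iff:
  assumes "a \<noteq> v"
  shows "btw v y a \<in> R \<longleftrightarrow> y \<noteq> v \<and> y \<noteq> a \<and> lies_between \<sigma> v y a"
proof (cases "distinct [v, y, a] \<and> {v, y, a} \<subseteq> V")
  case True
  then show ?thesis
    using btw_mem_iff_lies_between[OF dense linear, of v y a] consistent_at_centre by auto
next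
  case False
  then show ?thesis
    using dense_triplets_btwD[OF dense, of v y a] before_field assms centre
    by (auto simp: lies_between_def)
qed

lemma btw_opposite_mem_iff:
  assumes "u \<noteq> v" "(v, u) \<in> \<sigma>" "a \<in> V" "a \<noteq> v"
  shows "btw u v a \<in> R \<longleftrightarrow> (a, v) \<in> \<sigma>"
proof (cases "a = u")
  case True
  then show ?thesis
    using dense_triplets_btwD(1)[OF dense, of u v a] before_antisym assms by auto
next
  case False
  then show ?thesis
    using btw_mem_iff_lies_between[OF dense linear, of u v a] consistent_at_centre assms
      before_field before_antisym[of v u]
    by (auto simp: lies_between_def)
qed

lemma depth_less_depth:
  assumes "a \<noteq> v" "a \<noteq> b" "lies_between \<sigma> v a b"
  shows "depth R v a < depth R v b"
proof -
  have "b \<noteq> v"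
    using assms before_antisym unfolding lies_between_def by blast
  have "{y. btw v y b \<in> R} \<subseteq> V"
    using dense_triplets_btwD(2)[OF dense] by auto
  moreover have "a \<in> {y. btw v y b \<in> R} - {y. btw v y a \<in> R}"
    using assms btw_centre_mem_iff \<open>b \<noteq> v\<close> by simp
  moreover have "{y. btw v y a \<in> R} \<subseteq> {y. btw v y b \<in> R}"
    unfolding btw_centre_mem_iff[OF \<open>a \<noteq> v\<close>] btw_centre_mem_iff[OF \<open>b \<noteq> v\<close>]
    using assms before_antisym before_trans unfolding lies_between_def by blast
  ultimately show ?thesis
    unfolding depth_def using finite_subset[OF _ finite_V] by (intro psubset_card_mono) auto
qed

lemma position_strict_mono:
  assumes u: "u \<noteq> v" "(v, u) \<in> \<sigma>" and ab: "(a, b) \<in> \<sigma>" "a \<noteq> b"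
  shows "position R v u a < position R v u b"
proof -
  have "a \<in> V" "b \<in> V"
    using ab before_field by auto
  then have side: "btw u v c \<in> R \<longleftrightarrow> (c, v) \<in> \<sigma>" if "c \<in> {a, b}" "c \<noteq> v" for c
    using btw_opposite_mem_iff[OF u _ that(2)] that(1) by blast
  consider (separated) "a = v \<or> b = v \<or> (a, v) \<in> \<sigma> \<and> (v, b) \<in> \<sigma>"
    | (after) "a \<noteq> v" "b \<noteq> v" "(v, a) \<in> \<sigma>"
    | (before) "a \<noteq> v" "b \<noteq> v" "(b, v) \<in> \<sigma>"
    using before_total[OF \<open>a \<in> V\<close> centre] before_total[OF \<open>b \<in> V\<close> centre] by blast
  then show ?thesis
  proof cases
    case separated
    then show ?thesis
      using side ab before_antisym[of a v] before_antisym[of b v] by (auto simp: position_def)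
  next
    case after
    then have "depth R v a < depth R v b"
      using ab by (intro depth_less_depth) (auto simp: lies_between_def)
    moreover have "(a, v) \<notin> \<sigma>" "(b, v) \<notin> \<sigma>"
      using after ab before_antisym before_trans by blast+
    ultimately show ?thesis
      using after side by (simp add: position_def)
  next
    case before
    then have "depth R v b < depth R v a"
      using ab by (intro depth_less_depth) (auto simp: lies_between_def)
    moreover have "(a, v) \<in> \<sigma>"
      using before ab before_trans by blast
    ultimately show ?thesis
      using before side by (simp add: position_def)
  qed
qed

lemma key_order_break_ties_position:
  assumes u: "u \<noteq> v" "(v, u) \<in> \<sigma>" and r: "r ` V \<subseteq> {0..<N}"
  shows "key_order V (break_ties N r (position R v u)) = \<sigma>"
  using linear
proof (rule key_order_eqI)
  fix a b assume "(a, b) \<in> \<sigma>" "a \<noteq> b"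
  then have "position R v u a < position R v u b" "r a \<in> {0..<N}" "r b \<in> {0..<N}"
    using position_strict_mono[OF u] before_field r by blast+
  then show "break_ties N r (position R v u) a < break_ties N r (position R v u) b"
    by (rule break_ties_strict_mono)
qed

end

lemma exists_untouched_vertex:
  assumes "finite V" "finite F" "\<And>t. t \<in> F \<Longrightarrow> card (fst t) = 3" "3 * card F + 1 < card V"
  obtains v where "v \<in> V" "v \<noteq> u" "\<And>t. t \<in> F \<Longrightarrow> v \<notin> fst t"
proof -
  have "card (insert u (\<Union>t\<in>F. fst t)) \<le> 1 + (\<Sum>t\<in>F. card (fst t))"
    using card_UN_le[OF assms(2), of fst] by (intro order_trans[OF card_insert_le_m1]) auto
  also have "\<dots> < card V"
    using assms(3,4) by simp
  finally have "card (insert u (\<Union>t\<in>F. fst t)) < card V" .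
  moreover have "finite (\<Union>t\<in>F. fst t)"
    using assms(2,3) by (metis card.infinite finite_UN_I zero_neq_numeral)
  ultimately have "\<not> V \<subseteq> insert u (\<Union>t\<in>F. fst t)"
    by (meson card_mono finite_insert leD)
  then show thesis
    using that by blast
qed

lemma oriented_editionE:
  assumes "edition V R F" "u \<in> V" "v \<in> V" "u \<noteq> v"
  obtains \<sigma> where "linear_order_on V \<sigma>" "(v, u) \<in> \<sigma>" "inconsistent_triplets R \<sigma> \<subseteq> F"
proof -
  obtain \<sigma> where \<sigma>: "linear_order_on V \<sigma>" "inconsistent_triplets R \<sigma> \<subseteq> F"
    using editionE[OF assms(1)] .
  moreover have "inconsistent_triplets R (\<sigma>\<inverse>) = inconsistent_triplets R \<sigma>"
    by (simp add: inconsistent_triplets_def consistent_with_converse)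
  moreover have "(v, u) \<in> \<sigma> \<or> (v, u) \<in> \<sigma>\<inverse>"
    using \<sigma>(1) assms(2-4) by (auto simp: order_on_defs total_on_def)
  ultimately show thesis
    using that[of \<sigma>] that[of "\<sigma>\<inverse>"] by auto
qed

lemma small_edition_centre:
  assumes fin: "finite V" and dense: "dense_triplets V R" and "u \<in> V"
    and F: "edition V R F" "5 * card F < card V" and r: "r ` V \<subseteq> {0..<N}"
  obtains v where "v \<in> V"
    "inconsistent_triplets R (key_order V (break_ties N r (position R v u))) \<subseteq> F"
proof (cases "V = {u}")
  case True
  have "\<not> {x, y, z} \<subseteq> V" if "distinct [x, y, z]" for x y z
    using that True by auto
  then have "R = {}"
    using dense_tripletsE[OF dense] by (metis all_not_in_conv)
  then show thesis
    using that \<open>u \<in> V\<close> by (simp add: inconsistent_triplets_def)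
next
  case False
  have "F \<subseteq> R"
    using F(1) by (simp add: edition_def)
  then have card_fst: "card (fst t) = 3" if "t \<in> F" for t
    using dense_tripletsD(2)[OF dense] that by blast
  have "finite F"
    using finite_subset[OF \<open>F \<subseteq> R\<close> finite_dense_triplets[OF fin dense]] .
  have "card V \<noteq> 1"
    using False \<open>u \<in> V\<close> by (auto simp: card_1_singleton_iff)
  then have "3 * card F + 1 < card V"
    using F(2) by simp
  then obtain v where v: "v \<in> V" "v \<noteq> u" "\<And>t. t \<in> F \<Longrightarrow> v \<notin> fst t"
    using exists_untouched_vertex[OF fin \<open>finite F\<close> card_fst] by blast
  obtain \<sigma> where \<sigma>: "linear_order_on V \<sigma>" "(v, u) \<in> \<sigma>" "inconsistent_triplets R \<sigma> \<subseteq> F"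
    using oriented_editionE[OF F(1) \<open>u \<in> V\<close> v(1)] v(2) by blast
  interpret order_around V R \<sigma> v
    using fin dense \<sigma>(1,3) v(1,3) by unfold_locales (auto simp: inconsistent_triplets_def)
  have "key_order V (break_ties N r (position R v u)) = \<sigma>"
    using v(2) \<sigma>(2) r by (intro key_order_break_ties_position) auto
  then show thesis
    using that v(1) \<sigma>(3) by simp
qed

section \<open>Computing the keys from lists\<close>

text \<open>The sign of a key records the side of \<open>v\<close>: keys start as \<open>N + r a\<close> with \<open>0 \<le> r a < N\<close>, so
  flipping makes them negative, and pushing never changes their sign.\<close>

definition flip :: "'v \<Rightarrow> 'v \<Rightarrow> int \<Rightarrow> 'v triplet \<Rightarrow> ('v \<Rightarrow> int) \<Rightarrow> 'v \<Rightarrow> int" where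
  "flip v u N t K a = (if t = btw u v a then K a - 2 * N else K a)"

definition push :: "'v \<Rightarrow> int \<Rightarrow> 'v triplet \<Rightarrow> ('v \<Rightarrow> int) \<Rightarrow> 'v \<Rightarrow> int" where
  "push v N t K a = (if \<exists>y. t = btw v y a then K a + (if K a > 0 then N else - N) else K a)"

lemma fold_flip:
  assumes "distinct xs"
  shows "fold (flip v u N) xs K a = K a - (if btw u v a \<in> set xs then 2 * N else 0)"
  using assms by (induction xs arbitrary: K) (auto simp: flip_def)

lemma fold_push:
  assumes "distinct xs" "N \<ge> 0"
  shows "fold (push v N) xs K a = K a + (if K a > 0 then N else - N) * int (depth (set xs) v a)"
proof -
  let ?P = "\<lambda>t. \<exists>y. t = btw v y a"
  have "fold (push v N) xs K a = K a + (if K a > 0 then N else - N) * int (length (filter ?P xs))"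
    using assms(2) by (induction xs arbitrary: K) (auto simp: push_def algebra_simps)
  moreover have "length (filter ?P xs) = depth (set xs) v a"
  proof -
    have "{t. ?P t} \<inter> set xs = (\<lambda>y. btw v y a) ` {y. btw v y a \<in> set xs}"
      by auto
    moreover have "inj (\<lambda>y. btw v y a)"
      by (simp add: inj_def btw_def)
    ultimately show ?thesis
      unfolding distinct_length_filter[OF assms(1)] depth_def
      by (simp add: card_image inj_on_subset)
  qed
  ultimately show ?thesis by simp
qed

definition initial_key :: "'v \<Rightarrow> int \<Rightarrow> ('v \<Rightarrow> int) \<Rightarrow> 'v \<Rightarrow> int" where
  "initial_key v N r a = (if a = v then r a else N + r a)"

lemma fold_push_fold_flip:
  assumes dense: "dense_triplets V (set xs)" and "distinct xs" and r: "r a \<in> {0..<N}"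
  shows "fold (push v N) xs (fold (flip v u N) xs (initial_key v N r)) a =
    break_ties N r (position (set xs) v u) a"
proof -
  have "btw v y v \<notin> set xs" "btw u v v \<notin> set xs" for y
    using dense_triplets_btwD(1)[OF dense, of v y v] dense_triplets_btwD(1)[OF dense, of u v v]
    by auto
  then have "depth (set xs) v v = 0" "btw u v v \<notin> set xs"
    by (simp_all add: depth_def)
  then show ?thesis
    using assms(2) r
    by (simp add: fold_push fold_flip initial_key_def break_ties_def position_def algebra_simps)
qed

text \<open>Distances from the end of the list break ties between keys: the loop over the vertices has
  them in its counter.\<close>

primrec count_after :: "'v list \<Rightarrow> 'v \<Rightarrow> nat" where
  "count_after [] a = 0"
| "count_after (x # xs) a = (if a = x then length xs else count_after xs a)"

lemma count_after_nth:
  assumes "distinct xs" "i < length xs"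
  shows "count_after xs (xs ! i) = length xs - Suc i"
  using assms by (induction xs arbitrary: i) (auto simp: nth_Cons split: nat.split)

lemma count_after_less: "a \<in> set xs \<Longrightarrow> count_after xs a < length xs"
  by (induction xs) auto

lemma inj_on_count_after:
  assumes "distinct xs"
  shows "inj_on (count_after xs) (set xs)"
proof (rule inj_onI)
  fix a b assume "a \<in> set xs" "b \<in> set xs" and eq: "count_after xs a = count_after xs b"
  then obtain i j where ij: "a = xs ! i" "i < length xs" "b = xs ! j" "j < length xs"
    by (auto simp: in_set_conv_nth)
  then have "length xs - Suc i = length xs - Suc j"
    using eq assms by (simp add: count_after_nth)
  then have "i = j"
    using ij(2,4) by linarith
  then show "a = b"
    using ij(1,3) by simp
qed

fun btw_of :: "'v \<times> 'v \<times> 'v \<Rightarrow> 'v triplet" where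
  "btw_of (a, b, c) = btw a b c"

lemma case_btw_eq_btw_of: "(\<lambda>(a, b, c). btw a b c) = btw_of"
  by auto

fun violates :: "('v \<Rightarrow> int) \<Rightarrow> 'v \<times> 'v \<times> 'v \<Rightarrow> bool" where
  "violates K (x, y, z) \<longleftrightarrow> \<not> (K x < K y \<and> K y < K z \<or> K z < K y \<and> K y < K x)"

locale listed_instance =
  fixes vs :: "'v list" and ts :: "('v \<times> 'v \<times> 'v) list"
  assumes distinct_vertices: "distinct vs"
    and distinct_triplets: "distinct (map btw_of ts)"
    and dense: "dense_triplets (set vs) (set (map btw_of ts))"
begin

abbreviation "V \<equiv> set vs"
abbreviation "R \<equiv> set (map btw_of ts)"
abbreviation "N \<equiv> int (length vs)"

definition centred_key :: "'v \<Rightarrow> 'v \<Rightarrow> 'v \<Rightarrow> int" where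
  "centred_key v u = break_ties N (int \<circ> count_after vs) (position R v u)"

lemma tie_break_range: "(int \<circ> count_after vs) ` V \<subseteq> {0..<N}"
  by (auto simp: count_after_less)

lemma inj_on_centred_key: "inj_on (centred_key v u) V"
  unfolding centred_key_def using tie_break_range
  by (intro inj_on_break_ties comp_inj_on inj_on_count_after distinct_vertices) auto

lemma fold_push_fold_flip_centred:
  assumes "a \<in> V"
  shows "fold (push v N) (map btw_of ts) (fold (flip v u N) (map btw_of ts)
    (initial_key v N (int \<circ> count_after vs))) a = centred_key v u a"
  unfolding centred_key_def using tie_break_range assms
  by (intro fold_push_fold_flip[OF dense distinct_triplets]) auto

lemma triple_mem:
  assumes "(x, y, z) \<in> set ts"
  shows "distinct [x, y, z]" "x \<in> V" "y \<in> V" "z \<in> V"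
  using dense_triplets_btwD[OF dense, of x y z] assms by force+

definition violated :: "'v \<Rightarrow> 'v \<Rightarrow> ('v \<times> 'v \<times> 'v) list" where
  "violated v u = filter (violates (centred_key v u)) ts"

lemma set_violated:
  "set (map btw_of (violated v u)) = inconsistent_triplets R (key_order V (centred_key v u))"
proof -
  have "consistent_with (key_order V (centred_key v u)) (btw_of t) \<longleftrightarrow>
      \<not> violates (centred_key v u) t" if "t \<in> set ts" for t
  proof (cases t)
    case (fields x y z)
    then show ?thesis
      using that triple_mem[of x y z]
      by (simp add: consistent_with_key_order[OF inj_on_centred_key])
  qed
  then show ?thesis
    unfolding violated_def inconsistent_triplets_def by auto
qed

lemma distinct_violated: "distinct (map btw_of (violated v u))"
  unfolding violated_def using distinct_triplets by (rule distinct_map_filter)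

lemma card_violated: "card (set (map btw_of (violated v u))) = length (violated v u)"
  using distinct_card[OF distinct_violated] by simp

lemma edition_violated: "edition V R (set (map btw_of (violated v u)))"
  unfolding set_violated
proof (intro edition_inconsistent_triplets linear_order_on_key_order inj_on_centred_key)
  show "\<exists>S\<subseteq>V. triplet_on S t" if "t \<in> R" for t
    using dense that unfolding dense_triplets_def by blast
qed

lemma small_edition_violated:
  assumes "edition V R F" "5 * card F < length vs" "u \<in> V"
  obtains v where "v \<in> V" "length (violated v u) \<le> card F"
proof -
  have "card V = length vs"
    using distinct_card[OF distinct_vertices] .
  then obtain v where v: "v \<in> V" "set (map btw_of (violated v u)) \<subseteq> F"
    using small_edition_centre[OF _ dense assms(3,1) _ tie_break_range] assms(2)
    unfolding set_violated centred_key_def by auto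
  moreover have "finite F"
    using assms(1) finite_subset unfolding edition_def by blast
  ultimately show thesis
    using that[OF v(1)] card_mono[OF \<open>finite F\<close> v(2)] card_violated by simp
qed

end

section \<open>Timed Hoare triples\<close>

notation Seq (infixr ";;" 60)

definition hoare :: "(state \<Rightarrow> bool) \<Rightarrow> prog \<Rightarrow> nat \<Rightarrow> (state \<Rightarrow> bool) \<Rightarrow> bool" where
  "hoare P c T Q \<longleftrightarrow> (\<forall>s. P s \<longrightarrow> (\<exists>t s'. t \<le> T \<and> run c s t s' \<and> Q s'))"

lemma hoareI:
  assumes "\<And>s. P s \<Longrightarrow> \<exists>t s'. t \<le> T \<and> run c s t s' \<and> Q s'"
  shows "hoare P c T Q"
  using assms by (simp add: hoare_def)

lemma hoareE:
  assumes "hoare P c T Q" "P s"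
  obtains t s' where "t \<le> T" "run c s t s'" "Q s'"
  using assms unfolding hoare_def by blast

lemma hoare_conseq:
  assumes "hoare P c T Q" "\<And>s. P' s \<Longrightarrow> P s" "\<And>s. Q s \<Longrightarrow> Q' s" "T \<le> T'"
  shows "hoare P' c T' Q'"
  using assms unfolding hoare_def by (meson order_trans)

lemma hoare_state:
  assumes "\<And>s. P s \<Longrightarrow> hoare ((=) s) c T Q"
  shows "hoare P c T Q"
  using assms by (simp add: hoare_def)

lemma hoare_Seq:
  assumes "hoare P c T Q" "hoare Q d U R"
  shows "hoare P (c ;; d) (T + U) R"
proof (rule hoareI)
  fix s assume "P s"
  then obtain t s' where c: "t \<le> T" "run c s t s'" "Q s'"
    using assms(1) by (blast elim: hoareE)
  then obtain u s'' where d: "u \<le> U" "run d s' u s''" "R s''"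
    using assms(2) by (blast elim: hoareE)
  show "\<exists>t s'. t \<le> T + U \<and> run (c ;; d) s t s' \<and> R s'"
    using run.Seq[OF c(2) d(2)] c(1) d(1,3) by (blast intro: add_mono)
qed

lemma hoare_IfPos:
  assumes "hoare (\<lambda>s. P s \<and> fst s i > 0) c T Q" "hoare (\<lambda>s. P s \<and> \<not> fst s i > 0) d T Q"
  shows "hoare P (IfPos i c d) (Suc T) Q"
proof (rule hoareI)
  fix s assume "P s"
  show "\<exists>t s'. t \<le> Suc T \<and> run (IfPos i c d) s t s' \<and> Q s'"
  proof (cases "fst s i > 0")
    case True
    then obtain t s' where "t \<le> T" "run c s t s'" "Q s'"
      using assms(1) \<open>P s\<close> by (blast elim: hoareE)
    then show ?thesis
      using IfPosTrue[OF True, of c t s' d] by (intro exI[of _ "1 + t"] exI[of _ s']) simp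
  next
    case False
    then obtain t s' where "t \<le> T" "run d s t s'" "Q s'"
      using assms(2) \<open>P s\<close> by (blast elim: hoareE)
    then show ?thesis
      using IfPosFalse[OF False, of d t s' c] by (intro exI[of _ "1 + t"] exI[of _ s']) simp
  qed
qed

lemma hoare_WhilePos:
  assumes "\<And>i. i < n \<Longrightarrow> hoare (\<lambda>s. I i s \<and> fst s r = int (n - i)) c T
      (\<lambda>s. I (Suc i) s \<and> fst s r = int (n - Suc i))"
  shows "hoare (\<lambda>s. I 0 s \<and> fst s r = int n) (WhilePos r c) (n * Suc T + 1) (I n)"
  using assms
proof (induction n arbitrary: I)
  case 0
  show ?case
  proof (rule hoareI)
    fix s assume "I 0 s \<and> fst s r = int 0"
    then show "\<exists>t s'. t \<le> 0 * Suc T + 1 \<and> run (WhilePos r c) s t s' \<and> I 0 s'"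
      using WhilePosFalse[of s r c] by (intro exI[of _ 1] exI[of _ s]) simp
  qed
next
  case (Suc n)
  have rest: "hoare (\<lambda>s. I (Suc 0) s \<and> fst s r = int n) (WhilePos r c) (n * Suc T + 1) (I (Suc n))"
  proof (rule Suc.IH)
    fix i assume "i < n"
    then show "hoare (\<lambda>s. I (Suc i) s \<and> fst s r = int (n - i)) c T
        (\<lambda>s. I (Suc (Suc i)) s \<and> fst s r = int (n - Suc i))"
      using Suc.prems[of "Suc i"] by simp
  qed
  have first: "hoare (\<lambda>s. I 0 s \<and> fst s r = int (Suc n)) c T (\<lambda>s. I (Suc 0) s \<and> fst s r = int n)"
    using Suc.prems[of 0] by simp
  show ?case
  proof (rule hoareI)
    fix s assume s: "I 0 s \<and> fst s r = int (Suc n)"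
    then obtain t s' where t: "t \<le> T" "run c s t s'" "I (Suc 0) s' \<and> fst s' r = int n"
      using first by (blast elim: hoareE)
    then obtain u s'' where u: "u \<le> n * Suc T + 1" "run (WhilePos r c) s' u s''" "I (Suc n) s''"
      using rest by (blast elim: hoareE)
    have "run (WhilePos r c) s (1 + t + u) s''"
      using s t(2) u(2) by (intro WhilePosTrue) auto
    moreover have "1 + t + u \<le> Suc n * Suc T + 1"
      using t(1) u(1) by simp
    ultimately show "\<exists>t s'. t \<le> Suc n * Suc T + 1 \<and> run (WhilePos r c) s t s' \<and> I (Suc n) s'"
      using u(3) by blast
  qed
qed

fun loop_free :: "prog \<Rightarrow> bool" where
  "loop_free (c ;; d) \<longleftrightarrow> loop_free c \<and> loop_free d"
| "loop_free (IfPos i c d) \<longleftrightarrow> loop_free c \<and> loop_free d"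
| "loop_free (WhilePos i c) \<longleftrightarrow> False"
| "loop_free _ \<longleftrightarrow> True"

text \<open>On loops the values of \<open>cost\<close> and \<open>exec\<close> are irrelevant.\<close>

fun cost :: "prog \<Rightarrow> nat" where
  "cost (c ;; d) = cost c + cost d"
| "cost (IfPos i c d) = Suc (max (cost c) (cost d))"
| "cost _ = 1"

primrec exec :: "prog \<Rightarrow> state \<Rightarrow> state" where
  "exec Skip s = s"
| "exec (Const i c) s = ((fst s)(i := c), snd s)"
| "exec (Add i j l) s = ((fst s)(i := fst s j + fst s l), snd s)"
| "exec (Sub i j l) s = ((fst s)(i := fst s j - fst s l), snd s)"
| "exec (Load i j) s = ((fst s)(i := fst s (fst s j)), snd s)"
| "exec (Store i j) s = ((fst s)(fst s i := fst s j), snd s)"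
| "exec (Print i) s = (fst s, snd s @ [fst s i])"
| "exec (c ;; d) s = exec d (exec c s)"
| "exec (IfPos i c d) s = (if fst s i > 0 then exec c s else exec d s)"
| "exec (WhilePos i c) s = s"

lemma run_exec: "loop_free c \<Longrightarrow> \<exists>t\<le>cost c. run c s t (exec c s)"
proof (induction c arbitrary: s)
  case (Seq c d)
  obtain t u where "t \<le> cost c" "run c s t (exec c s)"
    "u \<le> cost d" "run d (exec c s) u (exec d (exec c s))"
    using Seq.IH(1)[of s] Seq.IH(2)[of "exec c s"] Seq.prems by auto
  then show ?case
    using run.Seq by (intro exI[of _ "t + u"]) auto
next
  case (IfPos i c d)
  obtain t u where "t \<le> cost c" "run c s t (exec c s)" "u \<le> cost d" "run d s u (exec d s)"
    using IfPos.IH[of s] IfPos.prems by auto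
  then show ?case
    using IfPosTrue[of s i c t] IfPosFalse[of s i d u]
    by (intro exI[of _ "if fst s i > 0 then 1 + t else 1 + u"]) auto
qed (cases s, auto simp: run.intros(1-7) simp del: One_nat_def intro: exI[of _ 1])

lemma hoare_loop_free:
  assumes "loop_free c" "\<And>s. P s \<Longrightarrow> Q (exec c s)" "cost c \<le> T"
  shows "hoare P c T Q"
  using run_exec[OF assms(1)] assms(2,3) unfolding hoare_def by (meson order_trans)

section \<open>The program\<close>

text \<open>The input occupies the addresses from \<open>0\<close> on, registers have small negative addresses, and
  the key of vertex \<open>a\<close> is kept at address \<open>-100 - a\<close>. Every piece of code only changes registers
  below those that its caller still needs.\<close>

abbreviation (input) "rBudget \<equiv> 0 :: int"
abbreviation (input) "rSize \<equiv> 1 :: int"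
abbreviation (input) "rInput \<equiv> 2 :: int"
abbreviation (input) "rBase \<equiv> -1 :: int"
abbreviation (input) "rOne \<equiv> -2 :: int"
abbreviation (input) "rPtrV \<equiv> -3 :: int"
abbreviation (input) "rLeftV \<equiv> -4 :: int"
abbreviation (input) "rV \<equiv> -5 :: int"
abbreviation (input) "rU \<equiv> -6 :: int"
abbreviation (input) "rDone \<equiv> -7 :: int"
abbreviation (input) "rPtr \<equiv> -8 :: int"
abbreviation (input) "rLeft \<equiv> -9 :: int"
abbreviation (input) "rX \<equiv> -10 :: int"
abbreviation (input) "rY \<equiv> -11 :: int"
abbreviation (input) "rZ \<equiv> -12 :: int"
abbreviation (input) "rTmp \<equiv> -13 :: int"
abbreviation (input) "rAddr \<equiv> -14 :: int"
abbreviation (input) "rKX \<equiv> -15 :: int"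
abbreviation (input) "rKY \<equiv> -16 :: int"
abbreviation (input) "rKZ \<equiv> -17 :: int"
abbreviation (input) "rCount \<equiv> -18 :: int"

definition addr :: "nat \<Rightarrow> int" where
  "addr a = -100 - int a"

primrec load_fields :: "int \<Rightarrow> int list \<Rightarrow> prog" where
  "load_fields p [] = Skip"
| "load_fields p (x # xs) = Load x p ;; Add p p rOne ;; load_fields p xs"

definition for_records :: "int \<Rightarrow> int \<Rightarrow> int list \<Rightarrow> prog \<Rightarrow> prog" where
  "for_records p r xs c = WhilePos r ((load_fields p xs ;; Sub r r rOne) ;; c)"

definition vertices_start :: "int \<Rightarrow> int \<Rightarrow> prog" where
  "vertices_start p r = Const p rInput ;; Load r rOne"

definition for_vertices :: "int \<Rightarrow> int \<Rightarrow> int \<Rightarrow> prog \<Rightarrow> prog" where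
  "for_vertices p r x c = vertices_start p r ;; for_records p r [x] c"

definition triples_start :: prog where
  "triples_start =
     Const rPtr rInput ;; Add rPtr rPtr rSize ;; Load rLeft rPtr ;; Add rPtr rPtr rOne"

definition for_triples :: "prog \<Rightarrow> prog" where
  "for_triples c = triples_start ;; for_records rPtr rLeft [rX, rY, rZ] c"

definition if_eq :: "int \<Rightarrow> int \<Rightarrow> prog \<Rightarrow> prog" where
  "if_eq i j c = Sub rTmp i j ;; IfPos rTmp Skip (Sub rTmp j i ;; IfPos rTmp Skip c)"

definition init_step :: prog where
  "init_step = Sub rAddr rBase rX ;; Add rTmp rSize rLeft ;; Store rAddr rTmp ;;
     if_eq rX rV (Store rAddr rLeft)"

definition both_ends :: "(int \<Rightarrow> int \<Rightarrow> prog) \<Rightarrow> prog" where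
  "both_ends e = e rX rZ ;; e rZ rX"

definition flip_end :: "int \<Rightarrow> int \<Rightarrow> prog" where
  "flip_end x z = if_eq rY rV (if_eq x rU
     (Sub rAddr rBase z ;; Load rTmp rAddr ;; Sub rTmp rTmp rSize ;; Sub rTmp rTmp rSize ;;
      Store rAddr rTmp))"

definition push_end :: "int \<Rightarrow> int \<Rightarrow> prog" where
  "push_end x z = if_eq x rV
     (Sub rAddr rBase z ;; Load rTmp rAddr ;;
      IfPos rTmp (Add rTmp rTmp rSize) (Sub rTmp rTmp rSize) ;; Store rAddr rTmp)"

definition if_violated :: "prog \<Rightarrow> prog" where
  "if_violated c = Sub rAddr rBase rX ;; Load rKX rAddr ;; Sub rAddr rBase rY ;; Load rKY rAddr ;;
     Sub rAddr rBase rZ ;; Load rKZ rAddr ;; Sub rTmp rKY rKX ;;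
     IfPos rTmp (Sub rTmp rKZ rKY ;; IfPos rTmp Skip c)
       (Sub rTmp rKX rKY ;; IfPos rTmp (Sub rTmp rKY rKZ ;; IfPos rTmp Skip c) c)"

definition report_prog :: prog where
  "report_prog = (Print rOne ;; Print rCount) ;;
     for_triples (if_violated (Print rX ;; Print rY ;; Print rZ)) ;; Const rDone 1"

definition keys_prog :: prog where
  "keys_prog = for_vertices rPtr rLeft rX init_step ;; for_triples (both_ends flip_end) ;;
     for_triples (both_ends push_end)"

definition attempt_prog :: prog where
  "attempt_prog = Const rCount 0 ;; keys_prog ;;
     for_triples (if_violated (Add rCount rCount rOne)) ;;
     (Sub rTmp rBudget rCount ;; Add rTmp rTmp rOne) ;; IfPos rTmp report_prog Skip"

definition prepare_prog :: prog where
  "prepare_prog = Const rBase (-100) ;; Const rOne 1 ;; Const rU rInput ;; Load rU rU"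

definition main_prog :: prog where
  "main_prog = prepare_prog ;; for_vertices rPtrV rLeftV rV (IfPos rDone Skip attempt_prog) ;;
     IfPos rDone Skip (Print rDone)"

lemma addr_eq_iff [simp]: "addr a = addr b \<longleftrightarrow> a = b"
  by (simp add: addr_def)

lemma addr_neq [simp]: "j > -100 \<Longrightarrow> addr a \<noteq> j" "j > -100 \<Longrightarrow> j \<noteq> addr a"
  by (auto simp: addr_def)

lemma base_minus_eq_addr [simp]: "-100 - int a = addr a"
  by (simp add: addr_def)

lemma exec_if_eq:
  assumes "i \<noteq> rTmp" "j \<noteq> rTmp"
  shows "exec (if_eq i j c) (m, out) =
    (if m i = m j then exec c (m(rTmp := 0), out) else (m(rTmp := \<bar>m i - m j\<bar>), out))"
  using assms by (auto simp: if_eq_def)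

section \<open>Loops over records\<close>

lemma exec_load_fields:
  assumes "m rOne = 1" "distinct (rOne # p # xs)" "\<forall>x\<in>set xs. x < 0" "p < 0" "m p \<ge> 0"
  shows "\<exists>m'. exec (load_fields p xs) (m, out) = (m', out) \<and> m' p = m p + int (length xs) \<and>
    (\<forall>l<length xs. m' (xs ! l) = m (m p + int l)) \<and> (\<forall>j. j \<notin> set (p # xs) \<longrightarrow> m' j = m j)"
  using assms
proof (induction xs arbitrary: m)
  case (Cons x xs)
  define m\<^sub>1 where "m\<^sub>1 = m(x := m (m p), p := m p + 1)"
  have "m\<^sub>1 rOne = 1" "m\<^sub>1 p \<ge> 0"
    using Cons.prems by (auto simp: m\<^sub>1_def)
  then obtain m' where m': "exec (load_fields p xs) (m\<^sub>1, out) = (m', out)"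
    "m' p = m\<^sub>1 p + int (length xs)" "\<And>l. l < length xs \<Longrightarrow> m' (xs ! l) = m\<^sub>1 (m\<^sub>1 p + int l)"
    "\<And>j. j \<notin> set (p # xs) \<Longrightarrow> m' j = m\<^sub>1 j"
    using Cons.IH[of m\<^sub>1] Cons.prems(2-4) by auto
  have "exec (load_fields p (x # xs)) (m, out) = (m', out)"
    using m'(1) Cons.prems(1,2) by (simp add: m\<^sub>1_def)
  moreover have "m' ((x # xs) ! l) = m (m p + int l)" if "l < length (x # xs)" for l
  proof (cases l)
    case 0
    then show ?thesis
      using m'(4)[of x] Cons.prems(2) by (simp add: m\<^sub>1_def)
  next
    case (Suc i)
    then show ?thesis
      using m'(3)[of i] that Cons.prems(3-) by (simp add: m\<^sub>1_def algebra_simps)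
  qed
  ultimately show ?case
    using m'(2,4) by (intro exI[of _ m']) (auto simp: m\<^sub>1_def)
qed simp

lemma loop_free_load_fields: "loop_free (load_fields p xs)"
  by (induction xs) auto

lemma cost_load_fields: "cost (load_fields p xs) = 2 * length xs + 1"
  by (induction xs) auto

definition pins_input :: "memory \<Rightarrow> (state \<Rightarrow> bool) \<Rightarrow> bool" where
  "pins_input inp P \<longleftrightarrow> (\<forall>s. P s \<longrightarrow> fst s rOne = 1 \<and> (\<forall>j\<ge>0. fst s j = inp j))"

definition independent_of :: "int set \<Rightarrow> (state \<Rightarrow> bool) \<Rightarrow> bool" where
  "independent_of A P \<longleftrightarrow> (\<forall>m m' out. P (m, out) \<longrightarrow> (\<forall>j. j \<notin> A \<longrightarrow> m' j = m j) \<longrightarrow> P (m', out))"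

lemma hoare_next_record:
  assumes regs: "distinct (rOne # p # r # xs)" "\<forall>j\<in>set (p # r # xs). j < 0" and "b \<ge> 0"
    and pins: "pins_input inp P" and indep: "independent_of (set (p # r # xs)) P"
  shows "hoare (\<lambda>s. P s \<and> fst s p = b \<and> fst s r = n) (load_fields p xs ;; Sub r r rOne)
    (2 * length xs + 2)
    (\<lambda>s. P s \<and> fst s p = b + int (length xs) \<and> fst s r = n - 1 \<and>
      (\<forall>l<length xs. fst s (xs ! l) = inp (b + int l)))"
    (is "hoare _ ?next _ ?Q")
proof (rule hoare_loop_free)
  fix s assume s: "P s \<and> fst s p = b \<and> fst s r = n"
  obtain m out where s_eq: "s = (m, out)"
    by (cases s)
  have m: "m rOne = 1" "m p = b" "m r = n" "\<And>j. j \<ge> 0 \<Longrightarrow> m j = inp j" "P (m, out)"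
    using s pins by (auto simp: s_eq pins_input_def)
  obtain m' where m': "exec (load_fields p xs) (m, out) = (m', out)"
    "m' p = m p + int (length xs)" "\<And>l. l < length xs \<Longrightarrow> m' (xs ! l) = m (m p + int l)"
    "\<And>j. j \<notin> set (p # xs) \<Longrightarrow> m' j = m j"
    using exec_load_fields[of m p xs out] m(1,2) regs \<open>b \<ge> 0\<close> by auto
  have "exec ?next s = (m'(r := n - 1), out)"
    using m'(1,4) m(1,3) regs(1) by (simp add: s_eq)
  moreover have "P (m'(r := n - 1), out)"
    using indep m(5) m'(4) unfolding independent_of_def
    by (metis fun_upd_apply list.set_intros set_ConsD)
  moreover have "(m'(r := n - 1)) (xs ! l) = inp (b + int l)" if "l < length xs" for l
    using m'(3)[OF that] m(2,4) \<open>b \<ge> 0\<close> regs(1) nth_mem[OF that] by auto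
  ultimately show "?Q (exec ?next s)"
    using m'(2) m(2) regs(1) by simp
qed (simp_all add: loop_free_load_fields cost_load_fields)

lemma hoare_for_records:
  assumes regs: "distinct (rOne # p # r # xs)" "\<forall>j\<in>set (p # r # xs). j < 0" and "b \<ge> 0"
    and pins: "\<And>i. pins_input inp (J i)" and indep: "\<And>i. independent_of (set (p # r # xs)) (J i)"
    and body: "\<And>i q. i < n \<Longrightarrow> hoare
      (\<lambda>s. J i s \<and> fst s p = q \<and> fst s r = int (n - Suc i) \<and>
        (\<forall>l<length xs. fst s (xs ! l) = inp (b + int (length xs * i + l))))
      c T (\<lambda>s. J (Suc i) s \<and> fst s p = q \<and> fst s r = int (n - Suc i))"
  shows "hoare (\<lambda>s. J 0 s \<and> fst s p = b \<and> fst s r = int n) (for_records p r xs c)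
    (n * (T + 2 * length xs + 3) + 1) (J n)"
proof -
  define I where "I = (\<lambda>i s. J i s \<and> fst s p = b + int (length xs * i))"
  have "hoare (\<lambda>s. I i s \<and> fst s r = int (n - i)) ((load_fields p xs ;; Sub r r rOne) ;; c)
      (2 * length xs + 2 + T) (\<lambda>s. I (Suc i) s \<and> fst s r = int (n - Suc i))" if "i < n" for i
  proof (rule hoare_conseq)
    have "b + int (length xs * i) \<ge> 0"
      using \<open>b \<ge> 0\<close> by simp
    from hoare_next_record[OF regs this pins indep] body[OF that]
    show "hoare (\<lambda>s. J i s \<and> fst s p = b + int (length xs * i) \<and> fst s r = int (n - i))
        ((load_fields p xs ;; Sub r r rOne) ;; c) (2 * length xs + 2 + T)
        (\<lambda>s. J (Suc i) s \<and> fst s p = b + int (length xs * i) + int (length xs) \<and>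
          fst s r = int (n - Suc i))"
      by (rule hoare_Seq[OF _ hoare_conseq]) (use that in \<open>auto simp: algebra_simps of_nat_diff\<close>)
  qed (auto simp: I_def algebra_simps)
  then have "hoare (\<lambda>s. I 0 s \<and> fst s r = int n) (for_records p r xs c)
      (n * Suc (2 * length xs + 2 + T) + 1) (I n)"
    unfolding for_records_def by (rule hoare_WhilePos)
  then show ?thesis
    by (rule hoare_conseq) (auto simp: I_def algebra_simps)
qed

section \<open>Encoded instances in memory\<close>

definition enc :: "(nat \<times> nat \<times> nat) list \<Rightarrow> int list" where
  "enc ts = concat (map (\<lambda>(a, b, c). [int a, int b, int c]) ts)"

lemma enc_simps [simp]: "enc [] = []" "enc ((a, b, c) # ts) = int a # int b # int c # enc ts"
  "enc (ts @ ts') = enc ts @ enc ts'"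
  by (simp_all add: enc_def)

lemma length_enc [simp]: "length (enc ts) = 3 * length ts"
  by (induction ts) auto

lemma nth_enc:
  assumes "i < length ts" "l < 3"
  shows "enc ts ! (3 * i + l) = enc [ts ! i] ! l"
proof -
  have "enc ts = enc (take i ts) @ enc [ts ! i] @ enc (drop (Suc i) ts)"
    using id_take_nth_drop[OF assms(1)] by (metis append_Cons append_Nil enc_simps(3))
  moreover have "length (enc (take i ts)) = 3 * i"
    using assms(1) by simp
  ultimately show ?thesis
    using assms(2) by (simp add: nth_append)
qed

locale encoded_instance = listed_instance vs ts
  for vs :: "nat list" and ts :: "(nat \<times> nat \<times> nat) list" +
  fixes k :: int
begin

definition ws :: "int list" where
  "ws = k # N # map int vs @ int (length ts) # enc ts"

lemma length_ws: "length ws = 3 + length vs + 3 * length ts"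
  by (simp add: ws_def)

lemma input_header:
  "load_input ws rBudget = k" "load_input ws rSize = N"
  "load_input ws (2 + N) = int (length ts)"
  by (simp_all add: load_input_def length_ws) (simp_all add: ws_def nth_append nat_add_distrib)

lemma input_vertex: "i < length vs \<Longrightarrow> load_input ws (2 + int i) = int (vs ! i)"
  by (simp add: load_input_def length_ws) (simp add: ws_def nth_append nat_add_distrib)

lemma input_triple:
  assumes "i < length ts" "l < 3"
  shows "load_input ws (3 + N + int (3 * i + l)) = enc [ts ! i] ! l"
proof -
  have "nat (3 + N + int (3 * i + l)) = Suc (Suc (length vs + Suc (3 * i + l)))"
    by simp
  moreover have "ws ! Suc (Suc (length vs + Suc (3 * i + l))) = enc ts ! (3 * i + l)"
    unfolding ws_def by (simp add: nth_append)
  ultimately show ?thesis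
    using nth_enc[OF assms] assms by (simp add: load_input_def length_ws)
qed

definition reference :: nat where
  "reference = nat (load_input ws rInput)"

lemma input_reference: "load_input ws rInput = int reference"
proof -
  have "load_input ws rInput \<ge> 0"
    using input_vertex[of 0] input_header(3) by (cases "vs = []") simp_all
  then show ?thesis
    by (simp add: reference_def)
qed

lemma reference_mem: "vs \<noteq> [] \<Longrightarrow> reference \<in> V"
  unfolding reference_def using input_vertex[of 0] by simp

definition answer :: "nat \<Rightarrow> int list" where
  "answer v = 1 # int (length (violated v reference)) # enc (violated v reference)"

definition succeeds :: "nat \<Rightarrow> bool" where
  "succeeds v \<longleftrightarrow> int (length (violated v reference)) \<le> k"

definition outcome :: "nat set \<Rightarrow> state \<Rightarrow> bool" where
  "outcome W s \<longleftrightarrow> fst s rDone = 0 \<and> snd s = [] \<and> (\<forall>v\<in>W. \<not> succeeds v) \<or>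
     fst s rDone = 1 \<and> (\<exists>v. succeeds v \<and> snd s = answer v)"

definition attempt_time :: nat where
  "attempt_time = length vs * 13 + length ts * 110 + 30"

definition ready :: "memory \<Rightarrow> bool" where
  "ready m \<longleftrightarrow> (\<forall>j\<ge>0. m j = load_input ws j) \<and> m rBase = -100 \<and> m rOne = 1"

lemma ready_simps:
  assumes "ready m"
  shows "m rBudget = k" "m rSize = N" "m (2 + N) = int (length ts)" "m rBase = -100" "m rOne = 1"
  using assms input_header by (simp_all add: ready_def)

lemma hoare_vertices_start:
  assumes "p \<noteq> r" "p \<noteq> rOne" and "p < 0" "r < 0"
    and ready: "\<And>s. P s \<Longrightarrow> ready (fst s)" and indep: "independent_of {p, r} P"
  shows "hoare P (vertices_start p r) 2 (\<lambda>s. P s \<and> fst s p = rInput \<and> fst s r = N)"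
    (is "hoare _ _ _ ?Q")
proof (rule hoare_loop_free)
  fix s assume s: "P s"
  obtain m out where s_eq: "s = (m, out)"
    by (cases s)
  have "exec (vertices_start p r) s = (m(p := rInput, r := N), out)"
    using ready[OF s] assms(1-4) by (auto simp: s_eq vertices_start_def ready_simps)
  moreover have "P (m(p := rInput, r := N), out)"
    using indep s unfolding independent_of_def s_eq by (auto elim!: allE)
  ultimately show "?Q (exec (vertices_start p r) s)"
    using assms(1) by simp
qed (simp_all add: vertices_start_def)

lemma hoare_for_vertices:
  assumes regs: "distinct [rOne, p, r, x]" "\<forall>j\<in>{p, r, x}. j < 0"
    and ready: "\<And>i s. J i s \<Longrightarrow> ready (fst s)" and indep: "\<And>i. independent_of {p, r, x} (J i)"
    and body: "\<And>i q. i < length vs \<Longrightarrow> hoare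
      (\<lambda>s. J i s \<and> fst s p = q \<and> fst s r = int (length vs - Suc i) \<and> fst s x = int (vs ! i))
      c T (\<lambda>s. J (Suc i) s \<and> fst s p = q \<and> fst s r = int (length vs - Suc i))"
  shows "hoare (J 0) (for_vertices p r x c) (length vs * (T + 5) + 3) (J (length vs))"
proof -
  have "independent_of {p, r} (J 0)"
    using indep[of 0] unfolding independent_of_def by blast
  then have start: "hoare (J 0) (vertices_start p r) 2 (\<lambda>s. J 0 s \<and> fst s p = rInput \<and> fst s r = N)"
    using regs ready by (intro hoare_vertices_start) auto
  have "hoare (\<lambda>s. J 0 s \<and> fst s p = rInput \<and> fst s r = N) (for_records p r [x] c)
      (length vs * (T + 2 * length [x] + 3) + 1) (J (length vs))"
  proof (rule hoare_for_records[where inp = "load_input ws"])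
    show "hoare (\<lambda>s. J i s \<and> fst s p = q \<and> fst s r = int (length vs - Suc i) \<and>
        (\<forall>l<length [x]. fst s ([x] ! l) = load_input ws (rInput + int (length [x] * i + l))))
        c T (\<lambda>s. J (Suc i) s \<and> fst s p = q \<and> fst s r = int (length vs - Suc i))"
      if "i < length vs" for i q
      using body[OF that] by (rule hoare_conseq) (auto simp: input_vertex[OF that])
  qed (use regs ready indep in \<open>auto simp: pins_input_def ready_def\<close>)
  then show ?thesis
    unfolding for_vertices_def by (rule hoare_conseq[OF hoare_Seq[OF start]]) auto
qed

end

section \<open>One attempt\<close>

lemma fold_apfst: "fold (\<lambda>t. apfst (g t)) xs (A, B) = (fold g xs A, B)"
  by (induction xs arbitrary: A) auto

lemma fold_apsnd_if_violates:
  "fold (\<lambda>t A. if violates (fst A) t then apsnd (g t) A else A) xs (K, B) =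
    (K, fold g (filter (violates K) xs) B)"
  by (induction xs arbitrary: B) auto

lemma fold_apfst_count: "fold (\<lambda>t. apfst (\<lambda>n. n + 1)) xs (n, B) = (n + int (length xs), B)"
  by (induction xs arbitrary: n) auto

lemma fold_apsnd_print: "fold (\<lambda>t. apsnd (\<lambda>out. out @ enc [t])) xs (A, out) = (A, out @ enc xs)"
  by (induction xs arbitrary: out) auto

type_synonym scratch = "(nat \<Rightarrow> int) \<times> int \<times> int list"

text \<open>\<open>m\<^sub>0\<close> is a logical variable: the memory at the start of the attempt with centre \<open>v\<close>.\<close>

locale attempt = encoded_instance vs ts k
  for vs :: "nat list" and ts :: "(nat \<times> nat \<times> nat) list" and k :: int +
  fixes m\<^sub>0 :: memory and v :: nat
  assumes start_ready: "ready m\<^sub>0"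
    and start_registers: "m\<^sub>0 rV = int v" "m\<^sub>0 rU = int reference"
begin

fun working :: "scratch \<Rightarrow> state \<Rightarrow> bool" where
  "working (K, n, out) (m, out') \<longleftrightarrow>
     (\<forall>j > rPtr. m j = m\<^sub>0 j) \<and> (\<forall>a\<in>V. m (addr a) = K a) \<and> m rCount = n \<and> out' = out"

lemma working_cong:
  assumes "working (K, n, out) s" "\<And>a. a \<in> V \<Longrightarrow> K a = K' a"
  shows "working (K', n, out) s"
  using assms by (cases s) simp

fun at_triple :: "int \<Rightarrow> int \<Rightarrow> nat \<times> nat \<times> nat \<Rightarrow> memory \<Rightarrow> bool" where
  "at_triple q l (x, y, z) m \<longleftrightarrow>
     m rPtr = q \<and> m rLeft = l \<and> m rX = int x \<and> m rY = int y \<and> m rZ = int z"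

lemma at_triple_iff:
  "at_triple q l t m \<longleftrightarrow>
     m rPtr = q \<and> m rLeft = l \<and> (\<forall>i<3. m ([rX, rY, rZ] ! i) = enc [t] ! i)"
  by (cases t) (auto simp: All_less_Suc numeral_3_eq_3)

lemma caller_cells:
  assumes "\<And>j. j > rPtr \<Longrightarrow> m j = m\<^sub>0 j"
  shows "ready m" "m rV = int v" "m rU = int reference" "m rBudget = k" "m rSize = N"
    "m (2 + N) = int (length ts)" "m rBase = -100" "m rOne = 1"
proof -
  show "ready m"
    using start_ready assms by (simp add: ready_def)
  then show "m rBudget = k" "m rSize = N" "m (2 + N) = int (length ts)"
    "m rBase = -100" "m rOne = 1"
    by (rule ready_simps)+
qed (use assms start_registers in simp_all)

abbreviation visiting :: "int \<Rightarrow> int \<Rightarrow> nat \<times> nat \<times> nat \<Rightarrow> scratch \<Rightarrow> state \<Rightarrow> bool" where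
  "visiting q l t A s \<equiv> working A s \<and> at_triple q l t (fst s)"

definition implements :: "prog \<Rightarrow> nat \<Rightarrow> (nat \<times> nat \<times> nat \<Rightarrow> scratch \<Rightarrow> scratch) \<Rightarrow> bool" where
  "implements c T f \<longleftrightarrow>
     (\<forall>t\<in>set ts. \<forall>A q l. hoare (visiting q l t A) c T (visiting q l t (f t A)))"

lemma ready_if_working: "working A s \<Longrightarrow> ready (fst s)"
  by (cases A; cases s) (simp add: caller_cells)

lemma independent_of_working: "independent_of {rPtr, rLeft, rX, rY, rZ} (working A)"
  unfolding independent_of_def by (cases A) auto

lemma hoare_triples_start:
  "hoare (working A) triples_start 4
    (\<lambda>s. working A s \<and> fst s rPtr = 3 + N \<and> fst s rLeft = int (length ts))"
    (is "hoare _ _ _ ?Q")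
proof (rule hoare_loop_free)
  fix s assume s: "working A s"
  then show "?Q (exec triples_start s)"
    using ready_simps[OF ready_if_working[OF s]] by (cases A; cases s) (simp add: triples_start_def)
qed (simp_all add: triples_start_def)

lemma hoare_for_triples:
  assumes c: "implements c T f"
  shows "hoare (working A) (for_triples c) (length ts * (T + 9) + 5) (working (fold f ts A))"
proof -
  let ?xs = "[rX, rY, rZ]" and ?J = "\<lambda>i. working (fold f (take i ts) A)"
  have "hoare (\<lambda>s. ?J 0 s \<and> fst s rPtr = 3 + N \<and> fst s rLeft = int (length ts))
      (for_records rPtr rLeft ?xs c) (length ts * (T + 2 * length ?xs + 3) + 1) (?J (length ts))"
  proof (rule hoare_for_records[where inp = "load_input ws"])
    fix i q assume i: "i < length ts"
    let ?l = "int (length ts - Suc i)"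
    from c nth_mem[OF i]
    have "hoare (visiting q ?l (ts ! i) (fold f (take i ts) A)) c T
        (visiting q ?l (ts ! i) (f (ts ! i) (fold f (take i ts) A)))"
      unfolding implements_def by blast
    then show "hoare (\<lambda>s. ?J i s \<and> fst s rPtr = q \<and> fst s rLeft = ?l \<and>
        (\<forall>l<length ?xs. fst s (?xs ! l) = load_input ws (3 + N + int (length ?xs * i + l)))) c T
        (\<lambda>s. ?J (Suc i) s \<and> fst s rPtr = q \<and> fst s rLeft = ?l)"
    proof (rule hoare_conseq)
      fix s assume s: "?J i s \<and> fst s rPtr = q \<and> fst s rLeft = ?l \<and>
        (\<forall>l<length ?xs. fst s (?xs ! l) = load_input ws (3 + N + int (length ?xs * i + l)))"
      then have "fst s (?xs ! l) = enc [ts ! i] ! l" if "l < 3" for l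
        using input_triple[OF i that] that by simp
      then show "visiting q ?l (ts ! i) (fold f (take i ts) A) s"
        using s by (simp add: at_triple_iff)
    qed (simp_all add: at_triple_iff take_Suc_conv_app_nth[OF i])
  qed (use ready_if_working independent_of_working in \<open>auto simp: pins_input_def ready_def\<close>)
  then show ?thesis
    unfolding for_triples_def
    by (intro hoare_conseq[OF hoare_Seq[OF hoare_triples_start]]) auto
qed

lemma implements_both_ends:
  assumes e: "\<And>x y z i a j c K n out q l m.
      (i, a, j, c) \<in> {(rX, x, rZ, z), (rZ, z, rX, x)} \<Longrightarrow> c \<in> V \<Longrightarrow>
      ready m \<Longrightarrow> m rV = int v \<Longrightarrow> m rU = int reference \<Longrightarrow>
      visiting q l (x, y, z) (K, n, out) (m, out) \<Longrightarrow>
      visiting q l (x, y, z) (f a y c K, n, out) (exec (e i j) (m, out))"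
    and T: "\<And>i j. loop_free (e i j) \<and> cost (e i j) \<le> T"
    and f: "\<And>x y z K. distinct [x, y, z] \<Longrightarrow> f z y x (f x y z K) = g (btw x y z) K"
  shows "implements (both_ends e) (T + T) (\<lambda>t. apfst (g (btw_of t)))"
  unfolding implements_def
proof (intro ballI allI)
  fix t q l and A :: scratch
  assume "t \<in> set ts"
  obtain x y z K n out where t: "t = (x, y, z)" and A: "A = (K, n, out)"
    by (metis prod_cases3)
  have mem: "distinct [x, y, z]" "x \<in> V" "z \<in> V"
    using \<open>t \<in> set ts\<close> t triple_mem by blast+
  have one_end: "hoare (visiting q l (x, y, z) (K, n, out)) (e i j) T
      (visiting q l (x, y, z) (f a y c K, n, out))"
    if "(i, a, j, c) \<in> {(rX, x, rZ, z), (rZ, z, rX, x)}" for i a j c K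
  proof (rule hoare_loop_free)
    fix s assume s: "visiting q l (x, y, z) (K, n, out) s"
    then obtain m where m: "s = (m, out)"
      by (cases s) simp
    show "visiting q l (x, y, z) (f a y c K, n, out) (exec (e i j) s)"
      using s that mem caller_cells[of m] unfolding m by (intro e) auto
  qed (use T in auto)
  have "hoare (visiting q l (x, y, z) (K, n, out)) (both_ends e) (T + T)
      (visiting q l (x, y, z) (f z y x (f x y z K), n, out))"
    unfolding both_ends_def by (rule hoare_Seq; rule one_end) simp_all
  then show "hoare (visiting q l t A) (both_ends e) (T + T)
      (visiting q l t (apfst (g (btw_of t)) A))"
    using f[OF mem(1)] by (simp add: t A)
qed

lemma implements_flip:
  "implements (both_ends flip_end) (13 + 13) (\<lambda>t. apfst (flip v reference N (btw_of t)))"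
proof (rule implements_both_ends
    [where f = "\<lambda>a b c K. if b = v \<and> a = reference then K(c := K c - 2 * N) else K"])
  fix x y z i a j c K n out q l m
  assume "(i, a, j, c) \<in> {(rX, x, rZ, z), (rZ, z, rX, x)}" "c \<in> V" "m rV = int v"
    "m rU = int reference" "visiting q l (x, y, z) (K, n, out) (m, out)" and "ready m"
  then show "visiting q l (x, y, z)
      (if y = v \<and> a = reference then K(c := K c - 2 * N) else K, n, out)
      (exec (flip_end i j) (m, out))"
    using ready_simps[OF \<open>ready m\<close>] by (auto simp: flip_end_def exec_if_eq)
qed (auto simp: flip_end_def if_eq_def flip_def btw_eq_iff fun_eq_iff)

lemma implements_push:
  "implements (both_ends push_end) (9 + 9) (\<lambda>t. apfst (push v N (btw_of t)))"
proof (rule implements_both_ends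
    [where f = "\<lambda>a b c K. if a = v then K(c := K c + (if K c > 0 then N else - N)) else K"])
  fix x y z i a j c K n out q l m
  assume "(i, a, j, c) \<in> {(rX, x, rZ, z), (rZ, z, rX, x)}" "c \<in> V" "m rV = int v"
    "visiting q l (x, y, z) (K, n, out) (m, out)" and "ready m"
  then show "visiting q l (x, y, z)
      (if a = v then K(c := K c + (if K c > 0 then N else - N)) else K, n, out)
      (exec (push_end i j) (m, out))"
    using ready_simps[OF \<open>ready m\<close>] by (auto simp: push_end_def exec_if_eq)
qed (auto simp: push_end_def if_eq_def push_def btw_eq_iff fun_eq_iff)

lemma implements_if_violated:
  assumes c: "loop_free c"
      "\<And>t A q l s. visiting q l t A s \<Longrightarrow> visiting q l t (apsnd (g t) A) (exec c s)"
  shows "implements (if_violated c) (cost c + 13)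
    (\<lambda>t A. if violates (fst A) t then apsnd (g t) A else A)"
  unfolding implements_def
proof (intro ballI allI hoare_loop_free)
  fix t A q l s assume "t \<in> set ts" and s: "visiting q l t A s"
  obtain x y z K n out m where t: "t = (x, y, z)" and A: "A = (K, n, out)" and m: "s = (m, out)"
    using s by (metis prod_cases3 prod.collapse working.simps)
  have cells: "m (addr x) = K x" "m (addr y) = K y" "m (addr z) = K z"
    "m rX = int x" "m rY = int y" "m rZ = int z" "m rBase = -100"
    using s triple_mem[of x y z] \<open>t \<in> set ts\<close> caller_cells[of m] by (simp_all add: t A m)
  define s' where "s' = exec (if_violated Skip) s"
  have exec: "exec (if_violated c) s = (if violates K t then exec c s' else s')"
    using cells by (simp add: s'_def t m if_violated_def)
  have s': "visiting q l t A s'"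
    using s cells by (simp add: s'_def t A m if_violated_def)
  show "visiting q l t (if violates (fst A) t then apsnd (g t) A else A) (exec (if_violated c) s)"
    using c(2)[OF s'] s' by (simp add: exec A)
qed (use c(1) in \<open>auto simp: if_violated_def\<close>)

definition initial :: "nat \<Rightarrow> int" where
  "initial = initial_key v N (int \<circ> count_after vs)"

lemma hoare_init:
  "hoare (\<lambda>(m, out). (\<forall>j > rPtr. m j = m\<^sub>0 j) \<and> m rCount = n \<and> out = [])
    (for_vertices rPtr rLeft rX init_step) (length vs * 13 + 3) (working (initial, n, []))"
proof -
  define J where "J = (\<lambda>i (s :: state). (\<forall>j > rPtr. fst s j = m\<^sub>0 j) \<and> fst s rCount = n \<and>
    snd s = [] \<and> (\<forall>l<i. fst s (addr (vs ! l)) = initial (vs ! l)))"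
  have "hoare (J 0) (for_vertices rPtr rLeft rX init_step) (length vs * (8 + 5) + 3)
    (J (length vs))"
  proof (intro hoare_for_vertices hoare_loop_free)
    fix i q s
    assume i: "i < length vs" and s: "J i s \<and> fst s rPtr = q \<and>
      fst s rLeft = int (length vs - Suc i) \<and> fst s rX = int (vs ! i)"
    obtain m where m: "s = (m, [])"
      using s by (cases s) (simp add: J_def)
    have cells: "m rBase = -100" "m rSize = N" "m rV = int v"
      using s caller_cells[of m] by (simp_all add: J_def m)
    have "vs ! l \<noteq> vs ! i" if "l < i" for l
      using that i distinct_vertices by (simp add: nth_eq_iff_index_eq)
    then show "J (Suc i) (exec init_step s) \<and> fst (exec init_step s) rPtr = q \<and>
        fst (exec init_step s) rLeft = int (length vs - Suc i)"
      using s cells count_after_nth[OF distinct_vertices i]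
      by (auto simp: m J_def init_step_def exec_if_eq initial_def initial_key_def less_Suc_eq)
  qed (use caller_cells in \<open>auto simp: J_def independent_of_def init_step_def if_eq_def\<close>)
  then show ?thesis
    by (rule hoare_conseq) (auto simp: J_def in_set_conv_nth)
qed

abbreviation "vertex_key \<equiv> centred_key v reference"
abbreviation "violations \<equiv> int (length (violated v reference))"

lemma hoare_keys:
  "hoare (\<lambda>(m, out). (\<forall>j > rPtr. m j = m\<^sub>0 j) \<and> m rCount = n \<and> out = []) keys_prog
    (length vs * 13 + length ts * 62 + 13) (working (vertex_key, n, []))"
proof -
  define K where "K = fold (\<lambda>t. flip v reference N (btw_of t)) ts initial"
  have "hoare (working (initial, n, [])) (for_triples (both_ends flip_end))
      (length ts * (26 + 9) + 5) (working (K, n, []))"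
    using hoare_for_triples[OF implements_flip, of "(initial, n, [])"]
    by (simp add: fold_apfst K_def)
  moreover have "hoare (working (K, n, [])) (for_triples (both_ends push_end))
      (length ts * (18 + 9) + 5) (working (fold (\<lambda>t. push v N (btw_of t)) ts K, n, []))"
    using hoare_for_triples[OF implements_push, of "(K, n, [])"] by (simp add: fold_apfst)
  ultimately have passes: "hoare
    (\<lambda>(m, out). (\<forall>j > rPtr. m j = m\<^sub>0 j) \<and> m rCount = n \<and> out = []) keys_prog
    (length vs * 13 + 3 + (length ts * (26 + 9) + 5 + (length ts * (18 + 9) + 5)))
    (working (fold (\<lambda>t. push v N (btw_of t)) ts K, n, []))"
    unfolding keys_prog_def by (intro hoare_Seq[OF hoare_init] hoare_Seq)
  have "fold (\<lambda>t. push v N (btw_of t)) ts K a = vertex_key a" if "a \<in> V" for a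
    using fold_push_fold_flip_centred[OF that, of v reference]
    by (simp add: K_def initial_def fold_map comp_def)
  then show ?thesis
    by (intro hoare_conseq[OF passes]) (auto elim!: working_cong)
qed

lemma hoare_count:
  "hoare (working (vertex_key, 0, []))
    (for_triples (if_violated (Add rCount rCount rOne))) (length ts * 23 + 5)
    (working (vertex_key, violations, []))"
proof -
  have "implements (if_violated (Add rCount rCount rOne)) (cost (Add rCount rCount rOne) + 13)
      (\<lambda>t A. if violates (fst A) t then apsnd (apfst (\<lambda>n. n + 1)) A else A)"
  proof (rule implements_if_violated)
    fix t A q l s assume "visiting q l t A s"
    then show "visiting q l t (apsnd (apfst (\<lambda>n. n + 1)) A) (exec (Add rCount rCount rOne) s)"
      using caller_cells(8)[of "fst s"] by (cases A; cases s; cases t) auto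
  qed simp
  from hoare_for_triples[OF this, of "(vertex_key, 0, [])"] show ?thesis
    by (simp add: fold_apsnd_if_violates fold_apfst_count violated_def)
qed

lemma hoare_report:
  "hoare (working (vertex_key, violations, [])) report_prog (length ts * 25 + 8)
    (\<lambda>(m, out). (\<forall>j > rDone. m j = m\<^sub>0 j) \<and> m rDone = 1 \<and> out = answer v)"
proof -
  let ?print = "Print rX ;; Print rY ;; Print rZ"
  have "implements (if_violated ?print) (cost ?print + 13)
      (\<lambda>t A. if violates (fst A) t then apsnd (apsnd (\<lambda>out. out @ enc [t])) A else A)"
  proof (rule implements_if_violated)
    fix t A q l s assume "visiting q l t A s"
    then show "visiting q l t (apsnd (apsnd (\<lambda>out. out @ enc [t])) A) (exec ?print s)"
      by (cases A; cases s; cases t) auto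
  qed simp
  from hoare_for_triples[OF this, of "(vertex_key, violations, [1, violations])"]
  have pass: "hoare (working (vertex_key, violations, [1, violations]))
      (for_triples (if_violated ?print)) (length ts * 25 + 5)
      (working (vertex_key, violations, answer v))"
    by (simp add: fold_apsnd_if_violates fold_apsnd_print violated_def answer_def)
  have header: "hoare (working (vertex_key, violations, []))
      (Print rOne ;; Print rCount) 2 (working (vertex_key, violations, [1, violations]))"
    using caller_cells by (intro hoare_loop_free) auto
  have finish: "hoare (working (vertex_key, violations, answer v)) (Const rDone 1) 1
      (\<lambda>(m, out). (\<forall>j > rDone. m j = m\<^sub>0 j) \<and> m rDone = 1 \<and> out = answer v)"
    by (intro hoare_loop_free) auto
  show ?thesis
    unfolding report_prog_def
    by (rule hoare_conseq[OF hoare_Seq[OF header hoare_Seq[OF pass finish]]]) simp_all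
qed

lemma hoare_attempt:
  assumes "m\<^sub>0 rDone = 0"
  shows "hoare ((=) (m\<^sub>0, [])) attempt_prog attempt_time
    (\<lambda>s. (\<forall>j > rDone. fst s j = m\<^sub>0 j) \<and> outcome {v} s)"
proof -
  let ?counted = "working (vertex_key, violations, [])"
  let ?Q = "\<lambda>s. (\<forall>j > rDone. fst s j = m\<^sub>0 j) \<and> outcome {v} s"
  have clear: "hoare ((=) (m\<^sub>0, [])) (Const rCount 0) 1
      (\<lambda>(m, out). (\<forall>j > rPtr. m j = m\<^sub>0 j) \<and> m rCount = 0 \<and> out = [])"
    by (rule hoare_loop_free) auto
  have compare: "hoare ?counted (Sub rTmp rBudget rCount ;; Add rTmp rTmp rOne) 2
      (\<lambda>s. ?counted s \<and> fst s rTmp = k - violations + 1)"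
    using caller_cells by (intro hoare_loop_free) auto
  have report: "hoare (\<lambda>s. ?counted s \<and> fst s rTmp = k - violations + 1)
      (IfPos rTmp report_prog Skip) (Suc (length ts * 25 + 8)) ?Q"
  proof (rule hoare_IfPos)
    show "hoare (\<lambda>s. (?counted s \<and> fst s rTmp = k - violations + 1) \<and> fst s rTmp > 0) report_prog
        (length ts * 25 + 8) ?Q"
    proof (cases "succeeds v")
      case True
      then show ?thesis
        by (intro hoare_conseq[OF hoare_report]) (auto simp: outcome_def)
    qed (auto simp: hoare_def succeeds_def)
    show "hoare (\<lambda>s. (?counted s \<and> fst s rTmp = k - violations + 1) \<and> \<not> fst s rTmp > 0) Skip
        (length ts * 25 + 8) ?Q"
      using assms by (intro hoare_loop_free) (auto simp: outcome_def succeeds_def)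
  qed
  show ?thesis
    unfolding attempt_prog_def
    by (rule hoare_conseq[OF hoare_Seq[OF clear hoare_Seq[OF hoare_keys
            hoare_Seq[OF hoare_count hoare_Seq[OF compare report]]]]])
      (simp_all add: attempt_time_def)
qed

end

section \<open>The algorithm\<close>

definition time_poly :: "nat poly" where
  "time_poly = [:9, 36, 123:]"

lemma length_le_bit_size: "length xs \<le> bit_size xs"
  by (induction xs) (auto simp: bit_size_def)

context encoded_instance begin

definition searching :: "nat set \<Rightarrow> state \<Rightarrow> bool" where
  "searching W s \<longleftrightarrow> ready (fst s) \<and> fst s rU = int reference \<and> outcome W s"

lemma hoare_guarded_attempt:
  "hoare (\<lambda>s. searching W s \<and> fst s rPtrV = q \<and> fst s rLeftV = l \<and> fst s rV = int v)
    (IfPos rDone Skip attempt_prog) (Suc attempt_time)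
    (\<lambda>s. searching (insert v W) s \<and> fst s rPtrV = q \<and> fst s rLeftV = l)"
    (is "hoare ?P _ _ ?Q")
proof (rule hoare_IfPos)
  show "hoare (\<lambda>s. ?P s \<and> fst s rDone > 0) Skip attempt_time ?Q"
    by (rule hoare_loop_free) (auto simp: searching_def outcome_def attempt_time_def)
  show "hoare (\<lambda>s. ?P s \<and> \<not> fst s rDone > 0) attempt_prog attempt_time ?Q"
  proof (rule hoare_state)
    fix s assume s: "?P s \<and> \<not> fst s rDone > 0"
    obtain m where m: "s = (m, [])" "m rDone = 0" "\<forall>w\<in>W. \<not> succeeds w"
      using s by (cases s) (auto simp: searching_def outcome_def)
    interpret attempt vs ts k m v
      using s by unfold_locales (auto simp: m searching_def)
    show "hoare ((=) s) attempt_prog attempt_time ?Q"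
      using hoare_attempt[OF m(2)] unfolding m(1)
    proof (rule hoare_conseq)
      fix s' assume s': "(\<forall>j > rDone. fst s' j = m j) \<and> outcome {v} s'"
      then have "ready (fst s')"
        using start_ready by (simp add: ready_def)
      then show "?Q s'"
        using s s' m by (auto simp: searching_def outcome_def)
    qed simp_all
  qed
qed

lemma hoare_search:
  "hoare (searching {}) (for_vertices rPtrV rLeftV rV (IfPos rDone Skip attempt_prog))
    (length vs * (Suc attempt_time + 5) + 3) (searching V)"
proof -
  have "hoare (searching (set (take 0 vs)))
    (for_vertices rPtrV rLeftV rV (IfPos rDone Skip attempt_prog))
    (length vs * (Suc attempt_time + 5) + 3) (searching (set (take (length vs) vs)))"
  proof (rule hoare_for_vertices)
    show "hoare (\<lambda>s. searching (set (take i vs)) s \<and> fst s rPtrV = q \<and>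
        fst s rLeftV = int (length vs - Suc i) \<and> fst s rV = int (vs ! i))
      (IfPos rDone Skip attempt_prog) (Suc attempt_time)
      (\<lambda>s. searching (set (take (Suc i) vs)) s \<and> fst s rPtrV = q \<and>
        fst s rLeftV = int (length vs - Suc i))" if "i < length vs" for i q
      using hoare_guarded_attempt by (simp add: take_Suc_conv_app_nth[OF that])
  qed (auto simp: searching_def outcome_def ready_def independent_of_def)
  then show ?thesis by simp
qed

lemma hoare_main:
  "hoare ((=) (load_input ws, [])) main_prog (length vs * (attempt_time + 6) + 9)
    (\<lambda>s. (\<exists>v. succeeds v \<and> snd s = answer v) \<or> snd s = [0] \<and> (\<forall>v\<in>V. \<not> succeeds v))"
    (is "hoare _ _ _ ?decided")
proof -
  have prepare: "hoare ((=) (load_input ws, [])) prepare_prog 4 (searching {})"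
  proof (rule hoare_loop_free)
    have "load_input ws rDone = 0"
      by (simp add: load_input_def)
    then show "searching {} (exec prepare_prog s)" if "(load_input ws, []) = s" for s
      using that
      by (auto simp: prepare_prog_def searching_def outcome_def ready_def input_reference)
  qed (simp_all add: prepare_prog_def)
  have finish: "hoare (searching V) (IfPos rDone Skip (Print rDone)) 2 ?decided"
    by (rule hoare_loop_free) (auto simp: searching_def outcome_def)
  show ?thesis
    unfolding main_prog_def
    by (rule hoare_conseq[OF hoare_Seq[OF prepare hoare_Seq[OF hoare_search finish]]]) simp_all
qed

lemma time_bound: "length vs * (attempt_time + 6) + 9 \<le> poly time_poly (bit_size ws)"
proof -
  define L where "L = bit_size ws"
  have L: "length vs \<le> L" "length ts \<le> L"
    using length_le_bit_size[of ws] by (simp_all add: L_def length_ws)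
  then have "length vs * (attempt_time + 6) \<le> L * (L * 13 + L * 110 + 36)"
    unfolding attempt_time_def by (intro mult_le_mono) simp_all
  then show ?thesis
    unfolding L_def[symmetric] by (simp add: time_poly_def algebra_simps)
qed

lemma answers_edition_answer: "answers_edition (set (map btw_of (violated v reference))) (answer v)"
proof -
  have "encodes_triplets (set (map btw_of (violated v reference)))
      (int (length (violated v reference)) # enc (violated v reference))"
    unfolding encodes_triplets_def enc_def case_btw_eq_btw_of
    using distinct_violated by (intro exI[of _ "violated v reference"]) simp
  then show ?thesis
    by (simp add: answers_edition_def answer_def)
qed

lemma no_small_edition:
  assumes "5 * k < N" "\<forall>v\<in>V. \<not> succeeds v"
  shows "\<not> (\<exists>F. edition V R F \<and> int (card F) \<le> k)"
proof
  assume "\<exists>F. edition V R F \<and> int (card F) \<le> k"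
  then obtain F where F: "edition V R F" "int (card F) \<le> k"
    by blast
  then have "5 * card F < length vs"
    using assms(1) by linarith
  moreover from this have "reference \<in> V"
    by (intro reference_mem) auto
  ultimately obtain v where "v \<in> V" "length (violated v reference) \<le> card F"
    using small_edition_violated[OF F(1)] by blast
  then show False
    using assms(2) F(2) by (auto simp: succeeds_def)
qed

theorem main_prog_decides:
  assumes "5 * k < N"
  shows "\<exists>out. outputs_within main_prog ws (poly time_poly (bit_size ws)) out \<and>
    ((\<exists>F. edition V R F \<and> int (card F) \<le> k \<and> answers_edition F out) \<or>
     (answers_none out \<and> \<not> (\<exists>F. edition V R F \<and> int (card F) \<le> k)))"
proof -
  obtain t m out where run: "t \<le> length vs * (attempt_time + 6) + 9"
      "run main_prog (load_input ws, []) t (m, out)"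
    and out: "(\<exists>v. succeeds v \<and> out = answer v) \<or> out = [0] \<and> (\<forall>v\<in>V. \<not> succeeds v)"
    using hoareE[OF hoare_main refl] by (metis prod.collapse)
  have "outputs_within main_prog ws (poly time_poly (bit_size ws)) out"
    using run time_bound unfolding outputs_within_def by (meson order_trans)
  moreover from out consider (success) v where "succeeds v" "out = answer v"
    | (failure) "out = [0]" "\<forall>v\<in>V. \<not> succeeds v"
    by blast
  then have "(\<exists>F. edition V R F \<and> int (card F) \<le> k \<and> answers_edition F out) \<or>
      (answers_none out \<and> \<not> (\<exists>F. edition V R F \<and> int (card F) \<le> k))"
  proof cases
    case success
    then show ?thesis
      using edition_violated answers_edition_answer card_violated unfolding succeeds_def by metis
  next
    case failure
    then show ?thesis
      using no_small_edition[OF assms] by (simp add: answers_none_def)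
  qed
  ultimately show ?thesis by blast
qed

end

lemma encodes_instanceE:
  assumes "encodes_instance V R k ws" "dense_triplets V R"
  obtains vs ts where "encoded_instance vs ts" "V = set vs" "R = set (map btw_of ts)"
    "ws = encoded_instance.ws vs ts k"
proof -
  obtain vs us where vs: "distinct vs" "set vs = V" "ws = k # int (length vs) # map int vs @ us"
    and "encodes_triplets R us"
    using assms(1) unfolding encodes_instance_def by blast
  then obtain ts where ts: "distinct (map btw_of ts)" "set (map btw_of ts) = R"
    "us = int (length ts) # enc ts"
    unfolding encodes_triplets_def enc_def case_btw_eq_btw_of by blast
  interpret encoded_instance vs ts k
    using vs ts assms(2) by unfold_locales simp_all
  show thesis
    using that[OF encoded_instance_axioms] vs ts ws_def by simp
qed

theorem theorem3:
  "\<exists>(alg :: prog) (p :: nat poly).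
     \<forall>(V :: nat set) (R :: nat triplet set) (k :: int) (ws :: int list).
       finite V \<longrightarrow> dense_triplets V R \<longrightarrow> real_of_int k < real (card V) / 5 \<longrightarrow>
       encodes_instance V R k ws \<longrightarrow>
       (\<exists>out. outputs_within alg ws (poly p (bit_size ws)) out \<and>
          ((\<exists>F. edition V R F \<and> int (card F) \<le> k \<and> answers_edition F out) \<or>
           (answers_none out \<and> \<not> (\<exists>F. edition V R F \<and> int (card F) \<le> k))))"
proof (intro exI[of _ main_prog] exI[of _ time_poly] allI impI)
  fix V :: "nat set" and R :: "nat triplet set" and k :: int and ws :: "int list"
  assume "dense_triplets V R" and k: "real_of_int k < real (card V) / 5"
    and "encodes_instance V R k ws"
  then obtain vs ts where listing: "encoded_instance vs ts" "V = set vs" "R = set (map btw_of ts)"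
    "ws = encoded_instance.ws vs ts k"
    by (blast elim: encodes_instanceE)
  then interpret encoded_instance vs ts k
    by blast
  have "5 * k < int (length vs)"
    using k distinct_card[OF distinct_vertices] unfolding listing(2) by linarith
  then show "\<exists>out. outputs_within main_prog ws (poly time_poly (bit_size ws)) out \<and>
      ((\<exists>F. edition V R F \<and> int (card F) \<le> k \<and> answers_edition F out) \<or>
       (answers_none out \<and> \<not> (\<exists>F. edition V R F \<and> int (card F) \<le> k)))"
    unfolding listing(2-4) by (rule main_prog_decides)
qed

end
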